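(* Let $L\geq 1$ be an integer parameter. There is a deterministic polynomial-time algorithm which, given an instance $(L,G)$ of the bootstrap problem, outputs a feasible solution $S$ with $|S|\leq L\cdot \mathrm{OPT}$, where $\mathrm{OPT}$ is the minimum cardinality of a feasible solution for $(L,G)$. That is, there is a deterministic polynomial-time approximation algorithm for the bootstrap problem within approximation factor $L$.
   Context: The bootstrap problem. The input is a positive integer $L$ and a directed acyclic graph $G=(V,E)$ (parallel edges allowed) in which every vertex has indegree $0$ or $2$; vertices of indegree $0$ are colored white and vertices of indegree $2$ are colored either blue or red. For a set $S\subseteq V$ of marked vertices, define $\ell:V\to\mathbb{Z}_{\geq 0}$ recursively (along a topological order) by: $\ell(v)=0$ if $v$ is white; $\ell(v)=\max_{(u,v)\in E}\ell(u)\cdot \mathbb{1}_{V\setminus S}(u)$ if $v$ is blue; $\ell(v)=\max_{(u,v)\in E}\ell(u)\cdot \mathbb{1}_{V\setminus S}(u)+1$ if $v$ is red, where $\mathbb{1}_{V\setminus S}$ equals $1$ on $V\setminus S$ and $0$ on $S$. The set $S$ is a feasible solution if $\max_{u\in V}\ell(u)\leq L$. The goal is to find a feasible solution of minimum cardinality; $\mathrm{OPT}$ denotes this minimum. A feasible solution $S'$ is an $\alpha$-approximate solution if $|S'|\leq\alpha\cdot\mathrm{OPT}$. *)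

theory Defs
  imports
    "Graph_Theory.Digraph"
    "HOL-Library.Indicator_Function"
    "HOL-Library.Log_Nat"
    "HOL-Computational_Algebra.Polynomial"
begin

section \<open>The bootstrap problem\<close>

text \<open>
  Graphs are the multi-digraphs of \<open>Graph_Theory\<close>: arcs have an identity of their own, so
  parallel arcs are allowed, and \<^const>\<open>in_degree\<close> counts them separately.
\<close>

datatype colour = White | Blue | Red

locale bootstrap_graph = fin_digraph G
  for G :: "('a, 'b) pre_digraph" (structure) +
  fixes col :: "'a \<Rightarrow> colour"
  assumes dag: "acyclic (arcs_ends G)"
    and colours: "v \<in> verts G \<Longrightarrow>
      in_degree G v = 0 \<and> col v = White \<or> in_degree G v = 2 \<and> (col v = Blue \<or> col v = Red)"

text \<open>
  \<open>level G col S\<close> is the function \<open>\<ell>\<close> for the set \<open>S\<close> of marked vertices. The recursion along a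
  topological order is well-founded recursion over the arc relation; the resulting recursion
  equation is \<open>level_rec\<close> below.
\<close>

definition level :: "('a, 'b) pre_digraph \<Rightarrow> ('a \<Rightarrow> colour) \<Rightarrow> 'a set \<Rightarrow> 'a \<Rightarrow> nat" where
  "level G col S = wfrec (arcs_ends G) (\<lambda>l v.
     case col v of
       White \<Rightarrow> 0
     | Blue \<Rightarrow> (MAX e\<in>in_arcs G v. l (tail G e) * indicator (verts G - S) (tail G e))
     | Red \<Rightarrow> (MAX e\<in>in_arcs G v. l (tail G e) * indicator (verts G - S) (tail G e)) + 1)"

definition feasible :: "nat \<Rightarrow> ('a, 'b) pre_digraph \<Rightarrow> ('a \<Rightarrow> colour) \<Rightarrow> 'a set \<Rightarrow> bool" where
  "feasible L G col S \<longleftrightarrow> S \<subseteq> verts G \<and> (\<forall>u\<in>verts G. level G col S u \<le> L)"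

definition OPT :: "nat \<Rightarrow> ('a, 'b) pre_digraph \<Rightarrow> ('a \<Rightarrow> colour) \<Rightarrow> nat" where
  "OPT L G col = Min (card ` {S. feasible L G col S})"

context bootstrap_graph
begin

lemma wf_arcs_ends: "wf (arcs_ends G)"
  using dag by (intro finite_acyclic_wf) (auto simp: arcs_ends_def)

lemma level_rec:
  "level G col S v = (case col v of
       White \<Rightarrow> 0
     | Blue \<Rightarrow> (MAX e\<in>in_arcs G v. level G col S (tail G e) * indicator (verts G - S) (tail G e))
     | Red \<Rightarrow> (MAX e\<in>in_arcs G v. level G col S (tail G e) * indicator (verts G - S) (tail G e)) + 1)"
proof -
  let ?F = "\<lambda>l v.
     case col v of
       White \<Rightarrow> 0
     | Blue \<Rightarrow> (MAX e\<in>in_arcs G v. l (tail G e) * indicator (verts G - S) (tail G e))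
     | Red \<Rightarrow> (MAX e\<in>in_arcs G v. l (tail G e) * indicator (verts G - S) (tail G e)) + 1"
  let ?l = "level G col S"
  have img: "(\<lambda>e. cut ?l (arcs_ends G) v (tail G e) * indicator (verts G - S) (tail G e)) ` in_arcs G v
      = (\<lambda>e. ?l (tail G e) * indicator (verts G - S) (tail G e)) ` in_arcs G v"
  proof (rule image_cong)
    fix e assume "e \<in> in_arcs G v"
    then have "(tail G e, v) \<in> arcs_ends G"
      by (auto simp: arcs_ends_def arc_to_ends_def)
    then show "cut ?l (arcs_ends G) v (tail G e) * indicator (verts G - S) (tail G e)
        = ?l (tail G e) * indicator (verts G - S) (tail G e)"
      by (simp only: cut_apply)
  qed (rule refl)
  have "?l v = ?F (cut ?l (arcs_ends G) v) v"
    by (rule def_wfrec[OF _ wf_arcs_ends]) (simp only: level_def)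
  then show ?thesis by (simp only: img)
qed

lemma feasible_verts:
  assumes "L \<ge> 1"
  shows "feasible L G col (verts G)"
proof -
  have "level G col (verts G) v \<le> L" if "v \<in> verts G" for v
  proof -
    have "(\<lambda>e. level G col (verts G) (tail G e) * indicator (verts G - verts G) (tail G e)) ` in_arcs G v = {0}"
      if "col v \<noteq> White"
    proof -
      have "in_degree G v = 2" using colours[OF \<open>v \<in> verts G\<close>] that by auto
      then have "in_arcs G v \<noteq> {}" by (auto simp: in_degree_def)
      then show ?thesis by auto
    qed
    then show ?thesis
      using assms by (subst level_rec) (auto split: colour.split)
  qed
  then show ?thesis by (auto simp: feasible_def)
qed

lemma OPT_attained:
  assumes "L \<ge> 1"
  shows "\<exists>S. feasible L G col S \<and> card S = OPT L G col"
    and "feasible L G col S \<Longrightarrow> OPT L G col \<le> card S"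
proof -
  have "{S. feasible L G col S} \<subseteq> Pow (verts G)" by (auto simp: feasible_def)
  then have fin: "finite {S. feasible L G col S}" by (rule finite_subset) simp
  have ne: "{S. feasible L G col S} \<noteq> {}" using feasible_verts[OF assms] by blast
  have "OPT L G col \<in> card ` {S. feasible L G col S}"
    unfolding OPT_def using fin ne by (intro Min_in) auto
  then show "\<exists>S. feasible L G col S \<and> card S = OPT L G col" by auto
  show "OPT L G col \<le> card S" if "feasible L G col S"
    unfolding OPT_def using fin that by (intro Min_le) auto
qed

end


section \<open>Deterministic polynomial-time algorithms\<close>

text \<open>
  Algorithms are programs of a random access machine over the natural numbers, presented as a
  while-language with scalar variables and arrays (named memory regions with computed addresses).
  Every operator, memory access and control step costs one unit. The only arithmetic
  operations are addition and truncated subtraction, so an execution of \<open>t\<close> steps only produces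
  numbers whose bit length exceeds that of the input numbers and the program constants by at most
  \<open>t\<close>. Hence unit-cost time is polynomially related to logarithmic-cost and Turing machine time;
  unit-cost multiplication would destroy this and is therefore not provided.
\<close>

type_synonym vname = string

type_synonym state = "(vname \<Rightarrow> nat) \<times> (vname \<Rightarrow> nat \<Rightarrow> nat)"

datatype aexp = N nat | V vname | Load vname aexp | Plus aexp aexp | Minus aexp aexp

datatype bexp = Less aexp aexp | Not bexp | And bexp bexp

datatype com =
    Skip
  | Assign vname aexp
  | Store vname aexp aexp
  | Seq com com
  | If bexp com com
  | While bexp com

fun aval :: "aexp \<Rightarrow> state \<Rightarrow> nat" where
  "aval (N k) s = k"
| "aval (V x) s = fst s x"
| "aval (Load A a) s = snd s A (aval a s)"
| "aval (Plus a b) s = aval a s + aval b s"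
| "aval (Minus a b) s = aval a s - aval b s"

fun bval :: "bexp \<Rightarrow> state \<Rightarrow> bool" where
  "bval (Less a b) s \<longleftrightarrow> aval a s < aval b s"
| "bval (Not b) s \<longleftrightarrow> \<not> bval b s"
| "bval (And b c) s \<longleftrightarrow> bval b s \<and> bval c s"

fun acost :: "aexp \<Rightarrow> nat" where
  "acost (N k) = 1"
| "acost (V x) = 1"
| "acost (Load A a) = acost a + 1"
| "acost (Plus a b) = acost a + acost b + 1"
| "acost (Minus a b) = acost a + acost b + 1"

fun bcost :: "bexp \<Rightarrow> nat" where
  "bcost (Less a b) = acost a + acost b + 1"
| "bcost (Not b) = bcost b + 1"
| "bcost (And b c) = bcost b + bcost c + 1"

definition assign :: "vname \<Rightarrow> nat \<Rightarrow> state \<Rightarrow> state" where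
  "assign x k s = ((fst s)(x := k), snd s)"

definition store :: "vname \<Rightarrow> nat \<Rightarrow> nat \<Rightarrow> state \<Rightarrow> state" where
  "store A i k s = (fst s, (snd s)(A := (snd s A)(i := k)))"

text \<open>
  \<open>exec c s t s'\<close>: started in state \<open>s\<close>, program \<open>c\<close> halts after \<open>t\<close> steps in state \<open>s'\<close>.
\<close>

inductive exec :: "com \<Rightarrow> state \<Rightarrow> nat \<Rightarrow> state \<Rightarrow> bool" where
  Skip: "exec Skip s 1 s"
| Assign: "exec (Assign x a) s (acost a + 1) (assign x (aval a s) s)"
| Store: "exec (Store A i a) s (acost i + acost a + 1) (store A (aval i s) (aval a s) s)"
| Seq: "exec c s t s' \<Longrightarrow> exec d s' u s'' \<Longrightarrow> exec (Seq c d) s (t + u + 1) s''"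
| IfTrue: "bval b s \<Longrightarrow> exec c s t s' \<Longrightarrow> exec (If b c d) s (bcost b + t + 1) s'"
| IfFalse: "\<not> bval b s \<Longrightarrow> exec d s t s' \<Longrightarrow> exec (If b c d) s (bcost b + t + 1) s'"
| WhileFalse: "\<not> bval b s \<Longrightarrow> exec (While b c) s (bcost b + 1) s"
| WhileTrue: "bval b s \<Longrightarrow> exec c s t s' \<Longrightarrow> exec (While b c) s' u s'' \<Longrightarrow>
    exec (While b c) s (bcost b + t + u + 1) s''"

lemma exec_deterministic:
  "exec c s t s' \<Longrightarrow> exec c s u s'' \<Longrightarrow> t = u \<and> s' = s''"
proof (induction arbitrary: u s'' rule: exec.induct)
  case (Seq c s t s' d v r)
  from Seq.prems show ?case using Seq.IH by cases blast
next
  case (IfTrue b s c t s' d)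
  from IfTrue.prems show ?case using IfTrue.hyps IfTrue.IH by cases blast+
next
  case (IfFalse b s d t s' c)
  from IfFalse.prems show ?case using IfFalse.hyps IfFalse.IH by cases blast+
next
  case (WhileTrue b s c t s' v r)
  from WhileTrue.prems show ?case
  proof cases
    case WhileFalse
    then show ?thesis using WhileTrue.hyps by simp
  next
    case (WhileTrue t' q v')
    then show ?thesis using WhileTrue.IH by blast
  qed
next
  case Skip
  then show ?case by cases auto
next
  case Assign
  then show ?case by cases auto
next
  case Store
  then show ?case by cases auto
next
  case WhileFalse
  from WhileFalse.prems show ?case using WhileFalse.hyps by cases auto
qed


section \<open>Encoding of instances and solutions\<close>

text \<open>
  An instance handed to an algorithm has vertices \<open>0, \<dots>, n - 1\<close> and arcs \<open>0, \<dots>, m - 1\<close>, in no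
  particular order; the vertex numbering need not be a topological order.
\<close>

definition bootstrap_input :: "nat \<Rightarrow> (nat, nat) pre_digraph \<Rightarrow> (nat \<Rightarrow> colour) \<Rightarrow> bool" where
  "bootstrap_input L G col \<longleftrightarrow> L \<ge> 1 \<and> bootstrap_graph G col \<and>
     verts G = {..<card (verts G)} \<and> arcs G = {..<card (arcs G)}"

fun colour_code :: "colour \<Rightarrow> nat" where
  "colour_code White = 0"
| "colour_code Blue = 1"
| "colour_code Red = 2"

definition initial_state :: "nat \<Rightarrow> (nat, nat) pre_digraph \<Rightarrow> (nat \<Rightarrow> colour) \<Rightarrow> state" where
  "initial_state L G col =
     ((\<lambda>_. 0)(''L'' := L, ''n'' := card (verts G), ''m'' := card (arcs G)),
      (\<lambda>_ _. 0)(
        ''tail'' := (\<lambda>e. if e \<in> arcs G then tail G e else 0),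
        ''head'' := (\<lambda>e. if e \<in> arcs G then head G e else 0),
        ''col'' := (\<lambda>v. if v \<in> verts G then colour_code (col v) else 0)))"

definition output_set :: "(nat, nat) pre_digraph \<Rightarrow> state \<Rightarrow> nat set" where
  "output_set G s = {v \<in> verts G. snd s ''S'' v \<noteq> 0}"

text \<open>
  The integer \<open>L\<close> is part of the input and is written in binary (\<open>floorlog 2 L\<close> is its bit length).
  Writing the vertex and arc indices in binary would enlarge the graph part by a logarithmic factor
  only, which is immaterial for polynomial bounds.
\<close>

definition input_size :: "nat \<Rightarrow> (nat, nat) pre_digraph \<Rightarrow> nat" where
  "input_size L G = card (verts G) + card (arcs G) + floorlog 2 L"

end

theory Submission
  imports Defs
begin

text \<open>
  A set \<open>S\<close> is feasible iff it hits every path that contains \<open>L\<close> red vertices and ends at a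
  predecessor of a red vertex. Take \<open>L\<close> copies of the graph, where a path moves to the next copy at each red
  vertex. A feasible \<open>S\<close> gives a vertex cut of size at most \<open>L * card S\<close> in this layered graph, and
  conversely the projection of any vertex cut is feasible. Hence the projection of a minimum vertex
  cut is an \<open>L\<close>-approximation. By duality, minimum vertex cuts correspond to minimum vertex covers of a
  bipartite graph with two copies of every node, and those are obtained from a maximum matching.
  An auction with integer prices finds the matching, and a gap in the final prices gives
  the cover. If \<open>L\<close> is at least the number of vertices, the empty set is feasible; so the number of
  layers is polynomial although \<open>L\<close> is given in binary.
\<close>

section \<open>Execution with time bounds\<close>

text \<open>Execution is deterministic, so the existential amounts to total correctness.
  \<open>T\<close> is only an upper bound, which lets branches of different cost share one
  bound.\<close>

definition runs :: "com \<Rightarrow> state \<Rightarrow> nat \<Rightarrow> (state \<Rightarrow> bool) \<Rightarrow> bool" where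
  "runs c s T P \<longleftrightarrow> (\<exists>t s'. exec c s t s' \<and> t \<le> T \<and> P s')"

fun wvars :: "com \<Rightarrow> vname set" where
  "wvars (Assign x a) = {x}"
| "wvars (Seq c d) = wvars c \<union> wvars d"
| "wvars (If b c d) = wvars c \<union> wvars d"
| "wvars (While b c) = wvars c"
| "wvars _ = {}"

fun warrs :: "com \<Rightarrow> vname set" where
  "warrs (Store A i a) = {A}"
| "warrs (Seq c d) = warrs c \<union> warrs d"
| "warrs (If b c d) = warrs c \<union> warrs d"
| "warrs (While b c) = warrs c"
| "warrs _ = {}"

definition frame :: "com \<Rightarrow> state \<Rightarrow> state \<Rightarrow> bool" where
  "frame c s s' \<longleftrightarrow> (\<forall>x. x \<notin> wvars c \<longrightarrow> fst s' x = fst s x) \<and> (\<forall>A. A \<notin> warrs c \<longrightarrow> snd s' A = snd s A)"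

lemma frame_fst: "frame c s s' \<Longrightarrow> x \<notin> wvars c \<Longrightarrow> fst s' x = fst s x"
  and frame_snd: "frame c s s' \<Longrightarrow> A \<notin> warrs c \<Longrightarrow> snd s' A = snd s A"
  by (auto simp: frame_def)

lemma fst_assign [simp]: "fst (assign x k s) = (fst s)(x := k)"
  and snd_assign [simp]: "snd (assign x k s) = snd s"
  and fst_store [simp]: "fst (store A i k s) = fst s"
  and snd_store [simp]: "snd (store A i k s) = (snd s)(A := (snd s A)(i := k))"
  by (auto simp: assign_def store_def)

lemma exec_frame: "exec c s t s' \<Longrightarrow> frame c s s'"
  by (induction rule: exec.induct) (auto simp: frame_def)

lemma runs_frame: "runs c s T P \<Longrightarrow> runs c s T (\<lambda>s'. P s' \<and> frame c s s')"
  unfolding runs_def using exec_frame by blast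

lemma runs_weaken: "runs c s T P \<Longrightarrow> T \<le> T' \<Longrightarrow> (\<And>s'. P s' \<Longrightarrow> Q s') \<Longrightarrow> runs c s T' Q"
  unfolding runs_def by (meson order_trans)

text \<open>The second premise receives the frame of \<open>c\<close> for free, so intermediate
  assertions record only what \<open>c\<close> changes.\<close>

lemma runs_Seq:
  assumes "runs c s T Q" and "\<And>s'. Q s' \<Longrightarrow> frame c s s' \<Longrightarrow> runs d s' U P"
  shows "runs (Seq c d) s (T + U + 1) P"
proof -
  from runs_frame[OF assms(1)] obtain t s' where 1: "exec c s t s'" "t \<le> T" "Q s'" "frame c s s'"
    by (auto simp: runs_def)
  with assms(2) obtain u s'' where "exec d s' u s''" "u \<le> U" "P s''"
    by (fastforce simp: runs_def)
  with 1 show ?thesis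
    unfolding runs_def by (intro exI[of _ "t + u + 1"] exI[of _ s'']) (auto intro: exec.Seq[simplified])
qed

lemma runs_If:
  assumes "bval b s \<Longrightarrow> runs c s T P" and "\<not> bval b s \<Longrightarrow> runs d s T P"
  shows "runs (If b c d) s (bcost b + T + 1) P"
proof (cases "bval b s")
  case True
  with assms obtain t s' where "exec c s t s'" "t \<le> T" "P s'" by (auto simp: runs_def)
  with True show ?thesis
    unfolding runs_def by (intro exI[of _ "bcost b + t + 1"] exI[of _ s']) (auto intro: exec.IfTrue[simplified])
next
  case False
  with assms obtain t s' where "exec d s t s'" "t \<le> T" "P s'" by (auto simp: runs_def)
  with False show ?thesis
    unfolding runs_def by (intro exI[of _ "bcost b + t + 1"] exI[of _ s']) (auto intro: exec.IfFalse[simplified])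
qed

text \<open>The variant \<open>\<mu>\<close> bounds the number of rounds: each pays for the body,
  one test and one control step; the failing test accounts for the final
  \<open>bcost b + 1\<close>.\<close>

lemma runs_While_aux:
  assumes "I s"
    and "\<And>s. I s \<Longrightarrow> bval b s \<Longrightarrow> runs c s B (\<lambda>s'. I s' \<and> \<mu> s' < (\<mu> s :: nat))"
  shows "runs (While b c) s (\<mu> s * (B + bcost b + 1) + bcost b + 1) (\<lambda>s'. I s' \<and> \<not> bval b s')"
  using assms(1)
proof (induction "\<mu> s" arbitrary: s rule: less_induct)
  case less
  show ?case
  proof (cases "bval b s")
    case True
    with assms(2) less.prems obtain t s' where 1: "exec c s t s'" "t \<le> B" "I s'" "\<mu> s' < \<mu> s"
      unfolding runs_def by blast
    from less.hyps[OF 1(4,3)] obtain u s'' where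
      2: "exec (While b c) s' u s''" "u \<le> \<mu> s' * (B + bcost b + 1) + bcost b + 1" "I s''" "\<not> bval b s''"
      unfolding runs_def by blast
    have "Suc (\<mu> s') * (B + bcost b + 1) \<le> \<mu> s * (B + bcost b + 1)"
      using 1(4) by (intro mult_right_mono) auto
    with 1 2 have "bcost b + t + u + 1 \<le> \<mu> s * (B + bcost b + 1) + bcost b + 1" by simp
    with exec.WhileTrue[OF True 1(1) 2(1)] 2 show ?thesis
      unfolding runs_def by blast
  next
    case False
    with less.prems show ?thesis
      unfolding runs_def by (intro exI[of _ "bcost b + 1"] exI[of _ s]) (auto intro: exec.WhileFalse[simplified])
  qed
qed

text \<open>The invariant is strengthened by the frame relative to the entry state, so
  \<open>I\<close> can be silent about whatever the body leaves alone.\<close>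

lemma runs_While:
  assumes "I s"
    and "\<And>s'. I s' \<Longrightarrow> frame c s s' \<Longrightarrow> bval b s' \<Longrightarrow> runs c s' B (\<lambda>s''. I s'' \<and> \<mu> s'' < (\<mu> s' :: nat))"
  shows "runs (While b c) s (\<mu> s * (B + bcost b + 1) + bcost b + 1) (\<lambda>s'. I s' \<and> \<not> bval b s')"
proof (rule runs_weaken[OF runs_While_aux[where I = "\<lambda>s'. I s' \<and> frame c s s'" and B = B and \<mu> = \<mu>]])
  show "I s \<and> frame c s s" using assms(1) by (simp add: frame_def)
  show "runs c s' B (\<lambda>s''. (I s'' \<and> frame c s s'') \<and> \<mu> s'' < \<mu> s')"
    if "I s' \<and> frame c s s'" "bval b s'" for s'
    by (rule runs_weaken[OF runs_frame[OF assms(2)]]) (use that in \<open>auto simp: frame_def\<close>)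
qed auto

section \<open>Programs without loops\<close>

fun loop_free :: "com \<Rightarrow> bool" where
  "loop_free (Seq c d) \<longleftrightarrow> loop_free c \<and> loop_free d"
| "loop_free (If b c d) \<longleftrightarrow> loop_free c \<and> loop_free d"
| "loop_free (While b c) \<longleftrightarrow> False"
| "loop_free _ \<longleftrightarrow> True"

text \<open>Loops get a dummy value here and in \<open>ccost\<close>; \<open>runs_effect\<close>
  excludes them by \<open>loop_free\<close>. Charging both branches of an \<open>If\<close> in
  \<open>ccost\<close> is an upper bound that avoids a maximum.\<close>

fun effect :: "com \<Rightarrow> state \<Rightarrow> state" where
  "effect (Assign x a) s = assign x (aval a s) s"
| "effect (Store A i a) s = store A (aval i s) (aval a s) s"
| "effect (Seq c d) s = effect d (effect c s)"
| "effect (If b c d) s = (if bval b s then effect c s else effect d s)"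
| "effect _ s = s"

fun ccost :: "com \<Rightarrow> nat" where
  "ccost (Assign x a) = acost a + 1"
| "ccost (Store A i a) = acost i + acost a + 1"
| "ccost (Seq c d) = ccost c + ccost d + 1"
| "ccost (If b c d) = bcost b + ccost c + ccost d + 1"
| "ccost _ = 1"

lemma runs_effect:
  assumes "loop_free c" and "P (effect c s)"
  shows "runs c s (ccost c) P"
proof -
  have "\<exists>t\<le>ccost c. exec c s t (effect c s)"
    using assms(1)
  proof (induction c arbitrary: s)
    case (Seq c d)
    then obtain t u where "t \<le> ccost c" "exec c s t (effect c s)"
      "u \<le> ccost d" "exec d (effect c s) u (effect d (effect c s))"
      by (metis loop_free.simps(1))
    then show ?case
      by (intro exI[of _ "t + u + 1"]) (auto intro: exec.Seq[simplified])
  next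
    case (If b c d)
    show ?case
    proof (cases "bval b s")
      case True
      moreover obtain t where "t \<le> ccost c" "exec c s t (effect c s)"
        using If by (metis loop_free.simps(2))
      ultimately show ?thesis
        by (intro exI[of _ "bcost b + t + 1"]) (auto intro: exec.IfTrue[simplified])
    next
      case False
      moreover obtain t where "t \<le> ccost d" "exec d s t (effect d s)"
        using If by (metis loop_free.simps(2))
      ultimately show ?thesis
        by (intro exI[of _ "bcost b + t + 1"]) (auto intro: exec.IfFalse[simplified])
    qed
  next
    case Skip
    show ?case by (intro exI[of _ "ccost Skip"]) (auto intro: exec.Skip[simplified])
  next
    case (Assign x a)
    show ?case by (intro exI[of _ "ccost (Assign x a)"]) (auto intro: exec.Assign[simplified])
  next
    case (Store A i a)
    show ?case by (intro exI[of _ "ccost (Store A i a)"]) (auto intro: exec.Store[simplified])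
  qed simp
  then show ?thesis using assms(2) unfolding runs_def by blast
qed

lemma runs_Assign: "acost a < T \<Longrightarrow> runs (Assign x a) s T (\<lambda>s'. s' = assign x (aval a s) s)"
  unfolding runs_def using exec.Assign[of x a s] by (intro exI conjI) auto

abbreviation Inc :: "vname \<Rightarrow> com" where
  "Inc x \<equiv> Assign x (Plus (V x) (N 1))"

definition For :: "vname \<Rightarrow> vname \<Rightarrow> com \<Rightarrow> com" where
  "For x y c = Seq (Assign x (N 0)) (While (Less (V x) (V y)) (Seq c (Inc x)))"

lemma wvars_For [simp]: "wvars (For x y c) = insert x (wvars c)"
  and warrs_For [simp]: "warrs (For x y c) = warrs c"
  by (auto simp: For_def)

text \<open>The invariant is indexed by the counter and holds after the increment, hence
  \<open>assign x (Suc i) s''\<close> in the step. The 9 is test, control, increment and sequencing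
  (3 + 1 + 4 + 1); the 7 is initialization, sequencing and the failing test (2 + 1 + 4).\<close>

lemma runs_For:
  assumes y: "fst s y = k" "y \<noteq> x" "y \<notin> wvars c" and x: "x \<notin> wvars c"
    and init: "I 0 (assign x 0 s)"
    and step: "\<And>i s'. i < k \<Longrightarrow> fst s' x = i \<Longrightarrow> frame (For x y c) s s' \<Longrightarrow> I i s' \<Longrightarrow>
      runs c s' B (\<lambda>s''. I (Suc i) (assign x (Suc i) s''))"
  shows "runs (For x y c) s (k * (B + 9) + 7) (I k)"
proof -
  let ?J = "\<lambda>s'. fst s' x \<le> k \<and> frame (For x y c) s s' \<and> I (fst s' x) s'"
  have "runs (While (Less (V x) (V y)) (Seq c (Inc x))) (assign x 0 s)
    (k * (B + 9) + 4) (I k)"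
  proof (rule runs_weaken)
    show "runs (While (Less (V x) (V y)) (Seq c (Inc x))) (assign x 0 s)
      ((\<lambda>s'. k - fst s' x) (assign x 0 s) * ((B + 4 + 1) + bcost (Less (V x) (V y)) + 1)
        + bcost (Less (V x) (V y)) + 1)
      (\<lambda>s'. ?J s' \<and> \<not> bval (Less (V x) (V y)) s')"
    proof (rule runs_While)
      show "?J (assign x 0 s)" using init by (auto simp: frame_def)
    next
      fix s' assume J: "?J s'" and b: "bval (Less (V x) (V y)) s'"
      have less: "fst s' x < k" using b J y by (auto simp: frame_def)
      show "runs (Seq c (Inc x)) s' (B + 4 + 1) (\<lambda>s''. ?J s'' \<and> k - fst s'' x < k - fst s' x)"
      proof (rule runs_Seq)
        show "runs c s' B (\<lambda>s''. I (Suc (fst s' x)) (assign x (Suc (fst s' x)) s''))"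
          using step[OF less] J by auto
      next
        fix s'' assume 1: "I (Suc (fst s' x)) (assign x (Suc (fst s' x)) s'')" and 2: "frame c s' s''"
        have "fst s'' x = fst s' x" using 2 x by (auto simp: frame_def)
        with 1 2 J less have "runs (Inc x) s'' (ccost (Inc x)) (\<lambda>s''. ?J s'' \<and> k - fst s'' x < k - fst s' x)"
          by (intro runs_effect) (auto simp: frame_def)
        then show "runs (Inc x) s'' 4 (\<lambda>s''. ?J s'' \<and> k - fst s'' x < k - fst s' x)"
          by (simp add: numeral_eq_Suc)
      qed
    qed
  next
    show "I k s'" if "?J s' \<and> \<not> bval (Less (V x) (V y)) s'" for s'
    proof -
      have "fst s' y = k" using that y by (auto simp: frame_def)
      with that have "fst s' x = k" by auto
      with that show ?thesis by auto
    qed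
  qed (auto simp: algebra_simps)
  then have "runs (For x y c) s (2 + (k * (B + 9) + 4) + 1) (I k)"
    unfolding For_def
  proof (intro runs_Seq[where Q = "\<lambda>s'. s' = assign x 0 s"])
    show "runs (Assign x (N 0)) s 2 (\<lambda>s'. s' = assign x 0 s)"
      using runs_Assign[of "N 0" 2 x s] by simp
  qed simp
  then show ?thesis by (simp add: algebra_simps)
qed


section \<open>Bipartite matching by an auction\<close>

text \<open>
  Left nodes bid for right nodes: \<open>p r\<close> is the price of \<open>r\<close>, \<open>own r\<close> its present owner, and \<open>q l\<close>
  the price that \<open>l\<close> pays for the node it owns. Price \<open>0\<close> means unmatched, on both sides.
\<close>

definition auction :: "(nat \<times> nat) set \<Rightarrow> (nat \<Rightarrow> nat) \<Rightarrow> (nat \<Rightarrow> nat) \<Rightarrow> (nat \<Rightarrow> nat) \<Rightarrow> bool" where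
  "auction E p q own \<longleftrightarrow>
     (\<forall>r. p r > 0 \<longrightarrow> (own r, r) \<in> E \<and> q (own r) = p r) \<and>
     inj_on own {r. p r > 0} \<and>
     (\<forall>l. q l > 0 \<longrightarrow> (\<exists>r. p r > 0 \<and> own r = l)) \<and>
     (\<forall>l r. (l, r) \<in> E \<longrightarrow> q l \<le> p r + 1)"

lemma auction_empty: "auction E (\<lambda>_. 0) (\<lambda>_. 0) own"
  by (simp add: auction_def)

text \<open>A bid for a cheapest neighbour exceeds the least price by one, just what the last clause
  of \<open>auction\<close> allows; prices never fall, so that clause survives elsewhere. If
  \<open>p r = 0\<close>, the value \<open>own r\<close> is junk and nobody may be evicted.\<close>

lemma auction_bid:
  assumes "auction E p q own" and "(l, r) \<in> E" and "q l = 0"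
    and "\<And>r'. (l, r') \<in> E \<Longrightarrow> p r \<le> p r'"
  shows "auction E (p(r := Suc (p r)))
    ((if p r > 0 then q(own r := 0) else q)(l := Suc (p r))) (own(r := l))"
proof -
  have a: "\<And>r. p r > 0 \<Longrightarrow> (own r, r) \<in> E \<and> q (own r) = p r"
    and b: "inj_on own {r. p r > 0}"
    and c: "\<And>l. q l > 0 \<Longrightarrow> \<exists>r. p r > 0 \<and> own r = l"
    and d: "\<And>l r. (l, r) \<in> E \<Longrightarrow> q l \<le> p r + 1"
    using assms(1) unfolding auction_def by blast+
  let ?p = "p(r := Suc (p r))" and ?o = "own(r := l)"
  let ?q = "(if p r > 0 then q(own r := 0) else q)(l := Suc (p r))"
  \<comment> \<open>Owners pay a positive price, but \<open>q l = 0\<close>: the bidder owns nothing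
    yet.\<close>
  have other: "own r' \<noteq> l" if "p r' > 0" for r'
    using a[OF that] that assms(3) by auto
  have distinct: "own r' \<noteq> own r" if "p r' > 0" "p r > 0" "r' \<noteq> r" for r'
    using b that by (auto dest: inj_onD)
  have "(?o r', r') \<in> E \<and> ?q (?o r') = ?p r'" if "?p r' > 0" for r'
    using a that assms(2) other distinct by (cases "r' = r") auto
  moreover have "inj_on ?o {r. ?p r > 0}"
    using b other by (auto simp: inj_on_def)
  moreover have "\<exists>r'. ?p r' > 0 \<and> ?o r' = l'" if "?q l' > 0" for l'
  proof (cases "l' = l")
    case False
    with that have "q l' > 0" "\<not> (p r > 0 \<and> own r = l')" by (auto split: if_splits)
    then obtain r' where "p r' > 0" "own r' = l'" "r' \<noteq> r" using c by blast
    then show ?thesis by (intro exI[of _ r']) auto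
  qed auto
  moreover have "?q l' \<le> ?p r' + 1" if "(l', r') \<in> E" for l' r'
  proof (cases "l' = l")
    case True
    then show ?thesis using assms(4) that by auto
  next
    case False
    then have "?q l' \<le> q l'" by auto
    also have "\<dots> \<le> ?p r' + 1" using d[OF that] by auto
    finally show ?thesis .
  qed
  ultimately show ?thesis unfolding auction_def by blast
qed

definition covers :: "'a set \<Rightarrow> 'b set \<Rightarrow> ('a \<times> 'b) set \<Rightarrow> bool" where
  "covers A B E \<longleftrightarrow> (\<forall>(l, r)\<in>E. l \<in> A \<or> r \<in> B)"

text \<open>Weak duality: a matched node outside \<open>B\<close> has its owner in \<open>A\<close>,
  and owners are distinct. Finiteness of the matching comes from the cover too, since
  \<open>E\<close> may be infinite.\<close>

lemma auction_le_cover: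
  assumes "auction E p q own" and "covers A B E" and "finite A" "finite B"
  shows "finite {r. p r > 0}" and "card {r. p r > 0} \<le> card A + card B"
proof -
  let ?M = "{r. p r > 0}"
  have sub: "own ` (?M - B) \<subseteq> A"
    using assms(1,2) unfolding auction_def covers_def by fastforce
  have inj: "inj_on own (?M - B)"
    using assms(1) unfolding auction_def by (auto intro: inj_on_subset)
  have fin: "finite (?M - B)" using sub inj assms(3) by (metis finite_imageD finite_subset)
  then show finM: "finite ?M" using assms(4) by simp
  have "card ?M \<le> card (?M - B) + card B"
    using card_Un_le[of "?M - B" B] card_mono[of "(?M - B) \<union> B" ?M] fin assms(4)
    by (meson Diff_partition finite_UnI le_trans Un_upper1 subsetI DiffI UnCI)
  moreover have "card (?M - B) \<le> card A"
    using card_inj_on_le[OF inj sub assms(3)] .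
  ultimately show "card ?M \<le> card A + card B" by simp
qed

text \<open>
  Koenig's theorem, with a gap \<open>t\<close> in the price range in place of alternating paths: owners pay
  at most one more than the price of any neighbour, so nobody pays across the gap.
\<close>

lemma auction_cover:
  assumes "auction E p q own" and "finite {r. p r > 0}"
    and stable: "\<forall>(l, r)\<in>E. q l = 0 \<longrightarrow> t < p r"
    and gap: "t \<notin> range p"
  shows "covers {l. 0 < q l \<and> q l < t} {r. t < p r} E"
    and "finite {l. 0 < q l \<and> q l < t}" and "finite {r. t < p r}"
    and "card {l. 0 < q l \<and> q l < t} + card {r. t < p r} \<le> card {r. p r > 0}"
proof -
  have a: "\<And>r. p r > 0 \<Longrightarrow> (own r, r) \<in> E \<and> q (own r) = p r"
    and c: "\<And>l. q l > 0 \<Longrightarrow> \<exists>r. p r > 0 \<and> own r = l"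
    and d: "\<And>l r. (l, r) \<in> E \<Longrightarrow> q l \<le> p r + 1"
    using assms(1) unfolding auction_def by blast+
  have q: "q l \<noteq> t" if "q l > 0" for l
    using c[OF that] a gap by (metis rangeI)
  show "covers {l. 0 < q l \<and> q l < t} {r. t < p r} E"
    unfolding covers_def
  proof (clarsimp, rule ccontr)
    fix l r assume e: "(l, r) \<in> E" "\<not> t < p r" and n: "\<not> (0 < q l \<and> q l < t)"
    \<comment> \<open>The gap enters twice: \<open>p r \<noteq> t\<close> gives
      \<open>q l \<le> p r + 1 \<le> t\<close>, and \<open>q l \<noteq> t\<close> makes this
      strict.\<close>
    have "p r < t" using e gap by (metis linorder_neqE_nat rangeI)
    moreover have "q l > 0" using stable e by force
    ultimately show False using n d[OF e(1)] q[of l] by auto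
  qed
  let ?A = "{r. 0 < p r \<and> p r < t}" and ?B = "{r. t < p r}"
  \<comment> \<open>A matched left node pays the price of the node it owns, so the cover takes at
    most one end of each matched edge.\<close>
  have sub: "{l. 0 < q l \<and> q l < t} \<subseteq> own ` ?A"
  proof
    fix l assume l: "l \<in> {l. 0 < q l \<and> q l < t}"
    then obtain r where "p r > 0" "own r = l" using c by blast
    with a[of r] l show "l \<in> own ` ?A" by auto
  qed
  have fA: "finite ?A" by (rule finite_subset[OF _ assms(2)]) auto
  show fB: "finite ?B" by (rule finite_subset[OF _ assms(2)]) auto
  show "finite {l. 0 < q l \<and> q l < t}" using sub fA by (metis finite_imageI finite_subset)
  have "card {l. 0 < q l \<and> q l < t} \<le> card ?A"
    using sub fA by (meson card_image_le card_mono finite_imageI le_trans)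
  moreover have "card ?A + card ?B = card (?A \<union> ?B)"
    using fA fB by (intro card_Un_disjoint[symmetric]) auto
  moreover have "card (?A \<union> ?B) \<le> card {r. p r > 0}"
    using assms(2) by (intro card_mono) auto
  ultimately show "card {l. 0 < q l \<and> q l < t} + card {r. t < p r} \<le> card {r. p r > 0}"
    by linarith
qed


section \<open>The layered graph\<close>

text \<open>
  Node \<open>v + j * n\<close> is vertex \<open>v\<close> in layer \<open>j\<close>, where \<open>j\<close> counts the red vertices on a path up to
  and including \<open>v\<close>. Every node \<open>i\<close> of the layers \<open>1, \<dots>, L\<close> is split into a right copy, which arcs
  enter, and a left copy, which they leave; matching the two copies of \<open>i\<close> means that no path uses
  \<open>i\<close>. Layer \<open>0\<close> holds one private source for every red vertex, and layer \<open>L + 1\<close> one private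
  sink for every vertex with a red successor.
\<close>

definition arc_edge :: "nat \<Rightarrow> (nat, nat) pre_digraph \<Rightarrow> (nat \<Rightarrow> colour) \<Rightarrow> nat \<Rightarrow> nat \<Rightarrow> nat \<times> nat" where
  "arc_edge L G col j e =
     (let n = card (verts G); b = Suc j * n; u = tail G e; v = head G e in
      (b + u, if col v \<noteq> Red then b + v else if Suc j < L then b + n + v else b + n + u))"

definition layered :: "nat \<Rightarrow> (nat, nat) pre_digraph \<Rightarrow> (nat \<Rightarrow> colour) \<Rightarrow> (nat \<times> nat) set" where
  "layered L G col =
     (\<lambda>v. (v, card (verts G) + v)) ` {v \<in> verts G. col v = Red} \<union>
     Id_on {card (verts G)..<Suc L * card (verts G)} \<union>
     (\<Union>j<L. arc_edge L G col j ` arcs G)"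

text \<open>A node is cut if both of its copies are chosen. Layer 0 has only left copies and layer
  \<open>L + 1\<close> only right copies, so one condition is waived at either end.\<close>

definition cut_of :: "nat \<Rightarrow> nat \<Rightarrow> nat set \<Rightarrow> nat set \<Rightarrow> nat set" where
  "cut_of L n A B = (\<lambda>i. i mod n) `
     {i. i < (L + 2) * n \<and> (i < n \<or> i \<in> B) \<and> (Suc L * n \<le> i \<or> i \<in> A)}"

section \<open>Levels in the original graph\<close>

context bootstrap_graph
begin

abbreviation red :: "'a \<Rightarrow> nat" where
  "red v \<equiv> (if col v = Red then 1 else 0)"

lemma head_coloured:
  assumes "e \<in> arcs G"
  shows "col (head G e) \<noteq> White"
proof
  assume "col (head G e) = White"
  then have "in_degree G (head G e) = 0" using colours[of "head G e"] assms by auto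
  moreover have "e \<in> in_arcs G (head G e)" using assms by simp
  moreover have "finite (in_arcs G (head G e))" by blast
  ultimately show False by (auto simp: in_degree_def)
qed

lemma level_arc:
  assumes "e \<in> arcs G" and "tail G e \<notin> S"
  shows "level G col S (tail G e) + red (head G e) \<le> level G col S (head G e)"
proof -
  let ?f = "\<lambda>e. level G col S (tail G e) * indicator (verts G - S) (tail G e) :: nat"
  have "?f e \<le> (MAX e\<in>in_arcs G (head G e). ?f e)"
    using assms(1) by (intro Max_ge finite_imageI imageI) auto
  moreover have "?f e = level G col S (tail G e)" using assms by simp
  ultimately show ?thesis
    using head_coloured[OF assms(1)]
    by (subst (2) level_rec) (auto split: colour.split)
qed

text \<open>This traces levels backwards: whatever exceeds the own contribution \<open>red v\<close>
  is inherited from an unmarked predecessor that attains the maximum.\<close>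

lemma level_pred:
  assumes "v \<in> verts G" and "level G col S v > red v"
  obtains e where "e \<in> arcs G" "head G e = v" "tail G e \<notin> S"
    "level G col S v = level G col S (tail G e) + red v"
proof -
  let ?f = "\<lambda>e. level G col S (tail G e) * indicator (verts G - S) (tail G e) :: nat"
  have c: "col v \<noteq> White"
    using assms(2) by (subst (asm) level_rec) auto
  then have "in_degree G v = 2" using colours[OF assms(1)] by auto
  then have "in_arcs G v \<noteq> {}" by (auto simp: in_degree_def)
  then have "(MAX e\<in>in_arcs G v. ?f e) \<in> ?f ` in_arcs G v" by (intro Max_in) auto
  then obtain e where e: "e \<in> in_arcs G v" "(MAX e\<in>in_arcs G v. ?f e) = ?f e" by auto
  have l: "level G col S v = ?f e + red v"
    using c e by (subst level_rec) (auto split: colour.split)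
  with assms(2) have "?f e > 0" by simp
  then have "tail G e \<notin> S" by (auto simp: indicator_def split: if_splits)
  with e l show ?thesis by (intro that[of e]) auto
qed

lemma arc_induct [consumes 1, case_names step]:
  assumes "v \<in> verts G"
    and "\<And>v. v \<in> verts G \<Longrightarrow> (\<And>e. e \<in> arcs G \<Longrightarrow> head G e = v \<Longrightarrow> P (tail G e)) \<Longrightarrow> P v"
  shows "P v"
  using wf_arcs_ends assms(1)
proof (induction v)
  case (less v)
  show ?case
  proof (rule assms(2)[OF less.prems])
    fix e assume "e \<in> arcs G" "head G e = v"
    then show "P (tail G e)" by (intro less.IH) (auto simp: arcs_ends_def arc_to_ends_def)
  qed
qed

text \<open>A step back to the predecessor that determines the level lowers it by at most one and,
  by acyclicity, loses the ancestor \<open>v\<close>. So ancestors, \<open>v\<close> included, bound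
  the level. This makes the empty set feasible when \<open>L\<close> is at least the number of
  vertices.\<close>

lemma level_le_card:
  assumes "v \<in> verts G"
  shows "level G col S v \<le> card (verts G)"
proof -
  let ?anc = "\<lambda>v. {u \<in> verts G. (u, v) \<in> (arcs_ends G)\<^sup>*}"
  have "level G col S v \<le> card (?anc v)"
    using assms
  proof (induction v rule: arc_induct)
    case (step v)
    have fin: "finite (?anc v)" by simp
    show ?case
    proof (cases "level G col S v > red v")
      case True
      with step.hyps obtain e where e: "e \<in> arcs G" "head G e = v"
        "level G col S v = level G col S (tail G e) + red v" by (metis level_pred)
      have a: "(tail G e, v) \<in> arcs_ends G" using e by (auto simp: arcs_ends_def arc_to_ends_def)
      have "v \<notin> ?anc (tail G e)"
        using a dag by (auto simp: acyclic_def dest: rtrancl_into_trancl1)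
      moreover have "insert v (?anc (tail G e)) \<subseteq> ?anc v"
        using a step.hyps by (auto intro: rtrancl_into_rtrancl)
      ultimately have "Suc (card (?anc (tail G e))) \<le> card (?anc v)"
        using card_mono[OF fin, of "insert v (?anc (tail G e))"] by simp
      then show ?thesis using step.IH[OF e(1,2)] e(3) by auto
    next
      case False
      moreover have "1 \<le> card (?anc v)"
        using card_mono[OF fin, of "{v}"] step.hyps by simp
      ultimately show ?thesis by (auto split: if_splits)
    qed
  qed
  also have "\<dots> \<le> card (verts G)" by (intro card_mono) auto
  finally show ?thesis .
qed

end

section \<open>Feasible sets and vertex covers of the layered graph\<close>

locale bootstrap_instance =
  fixes L :: nat and G :: "(nat, nat) pre_digraph" and col :: "nat \<Rightarrow> colour"
  assumes input: "bootstrap_input L G col"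
begin

sublocale bootstrap_graph G col
  using input by (simp add: bootstrap_input_def)

abbreviation n :: nat where "n \<equiv> card (verts G)"
abbreviation m :: nat where "m \<equiv> card (arcs G)"

lemma L_pos: "L \<ge> 1" and verts_eq: "verts G = {..<n}" and arcs_eq: "arcs G = {..<m}"
  using input by (simp_all add: bootstrap_input_def)

lemma in_verts_iff: "v \<in> verts G \<longleftrightarrow> v < n"
  using verts_eq by blast

lemma in_arcs_iff: "e \<in> arcs G \<longleftrightarrow> e < m"
  using arcs_eq by blast

lemma source_edge: "v < n \<Longrightarrow> col v = Red \<Longrightarrow> (v, n + v) \<in> layered L G col"
  by (auto simp: layered_def in_verts_iff)

lemma split_edge: "n \<le> i \<Longrightarrow> i < Suc L * n \<Longrightarrow> (i, i) \<in> layered L G col"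
  by (auto simp: layered_def Id_on_def)

lemma arc_edge_layered: "e \<in> arcs G \<Longrightarrow> j < L \<Longrightarrow> arc_edge L G col j e \<in> layered L G col"
  by (auto simp: layered_def)

lemma tail_less: "e \<in> arcs G \<Longrightarrow> tail G e < n" and head_less: "e \<in> arcs G \<Longrightarrow> head G e < n"
  using in_verts_iff tail_in_verts head_in_verts by blast+

lemma layer_less:
  assumes "v < n" and "j < k"
  shows "v + j * n < k * n"
proof -
  have "Suc j * n \<le> k * n" using assms by (intro mult_right_mono) auto
  with assms show ?thesis by simp
qed

text \<open>Right ends carry the prices: bounding them limits both the total price and the scan for
  a gap.\<close>

lemma layered_bound:
  assumes "(l, r) \<in> layered L G col"
  shows "r < (L + 2) * n"
proof -
  consider v where "v < n" "r = v + 1 * n"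
    | "r < Suc L * n"
    | j e where "j < L" "e \<in> arcs G" "(l, r) = arc_edge L G col j e"
    using assms by (auto simp: layered_def in_verts_iff)
  then show ?thesis
  proof cases
    case 1
    then show ?thesis using layer_less[of v 1 "L + 2"] by simp
  next
    case 2
    then show ?thesis by simp
  next
    case 3
    then obtain v where "v < n" "r = v + Suc j * n \<or> r = v + Suc (Suc j) * n"
      using tail_less head_less by (auto simp: arc_edge_def Let_def split: if_splits)
    then show ?thesis
      using layer_less[of v "Suc j" "L + 2"] layer_less[of v "Suc (Suc j)" "L + 2"] 3 by auto
  qed
qed

text \<open>\<open>B\<close> takes the right copies in layers up to the level of the vertex,
  \<open>A\<close> the remaining left copies and all copies of marked vertices. An arc from an
  unmarked vertex cannot leave the region below the levels, so every edge is covered. Apart from the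
  at most \<open>L * card S\<close> marked copies, each of the \<open>L * n\<close> inner nodes is
  counted once.\<close>

lemma cover_of_feasible:
  assumes "feasible L G col S"
  obtains A B where "covers A B (layered L G col)" "finite A" "finite B"
    "card A + card B \<le> L * n + L * card S"
proof -
  let ?l = "level G col S"
  let ?I = "{n..<Suc L * n}"
  define B where "B = {i \<in> ?I. i div n \<le> ?l (i mod n)}"
  define C where "C = {i \<in> ?I. i mod n \<in> S}"
  have S: "S \<subseteq> verts G" and lev: "\<And>v. v \<in> verts G \<Longrightarrow> ?l v \<le> L"
    using assms by (auto simp: feasible_def)
  have inI: "v + j * n \<in> ?I \<longleftrightarrow> j \<in> {1..L}" if "v < n" for v j
    using layer_less[OF that, of j "Suc L"] that mult_le_mono1[of 1 j n] mult_le_mono1[of "Suc L" j n]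
    by (cases "j = 0"; cases "j < Suc L") (auto simp: trans_le_add2)
  have inB: "v + j * n \<in> B \<longleftrightarrow> j \<in> {1..L} \<and> j \<le> ?l v"
    and inC: "v + j * n \<in> C \<longleftrightarrow> j \<in> {1..L} \<and> v \<in> S" if "v < n" for v j
    using that inI[OF that, of j] by (cases "n = 0"; auto simp: B_def C_def)+
  let ?A = "(?I - B) \<union> C"
  have "l \<in> ?A \<or> r \<in> B" if "(l, r) \<in> layered L G col" for l r
  proof -
    from that consider v where "v < n" "col v = Red" "l = v" "r = v + n"
      | "l = r" "r \<in> ?I"
      | j e where "j < L" "e \<in> arcs G" "(l, r) = arc_edge L G col j e"
      by (auto simp: layered_def in_verts_iff)
    then show ?thesis
    proof cases
      case 1
      have "?l v \<ge> 1" using 1(2) by (subst level_rec) simp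
      then show ?thesis using inB[of v 1] 1 L_pos by simp
    next
      case 2
      then show ?thesis by blast
    next
      case 3
      let ?u = "tail G e" and ?v = "head G e"
      have l: "l = ?u + Suc j * n" using 3 by (simp add: arc_edge_def Let_def)
      show ?thesis
      proof (rule ccontr)
        assume not: "\<not> (l \<in> ?A \<or> r \<in> B)"
        then have u: "?u \<notin> S" "Suc j \<le> ?l ?u"
          using inI[of ?u "Suc j"] inB[of ?u "Suc j"] inC[of ?u "Suc j"] tail_less[OF 3(2)] 3(1)
          unfolding l by auto
        have v: "?l ?u + red ?v \<le> ?l ?v" using level_arc[OF 3(2) u(1)] .
        have "?l ?v \<le> L" using lev 3(2) by auto
        \<comment> \<open>An edge into a sink would start in layer \<open>Suc j = L\<close> and have
          a red head, whose level would be at least \<open>L + 1\<close>.\<close>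
        then have sink: "\<not> (col ?v = Red \<and> \<not> Suc j < L)" using u v 3(1) by auto
        then have "r = ?v + (Suc j + red ?v) * n"
          using 3 by (auto simp: arc_edge_def Let_def)
        moreover have "Suc j + red ?v \<in> {1..L}" using sink 3(1) by auto
        ultimately have "r \<in> B"
          using inB[of ?v "Suc j + red ?v"] head_less[OF 3(2)] u v by auto
        with not show False by blast
      qed
    qed
  qed
  then have cov: "covers ?A B (layered L G col)" by (auto simp: covers_def)
  have fin: "finite B" "finite C" by (auto simp: B_def C_def)
  have "C \<subseteq> (\<lambda>(j, v). v + j * n) ` ({1..L} \<times> S)"
  proof
    fix i assume i: "i \<in> C"
    then have "i mod n < n" using S in_verts_iff by (auto simp: C_def)
    then have "i div n \<in> {1..L}" using inC[of "i mod n" "i div n"] i by simp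
    then show "i \<in> (\<lambda>(j, v). v + j * n) ` ({1..L} \<times> S)"
      using i by (intro image_eqI[of _ _ "(i div n, i mod n)"]) (auto simp: C_def)
  qed
  then have "card C \<le> card ({1..L} \<times> S)"
    using finite_subset[OF S] by (intro surj_card_le) auto
  then have cC: "card C \<le> L * card S" by (simp add: card_cartesian_product)
  have "card ?A \<le> card (?I - B) + card C" by (rule card_Un_le)
  moreover have "card (?I - B) + card B = card ?I"
  proof -
    have "B \<subseteq> ?I" by (auto simp: B_def)
    then show ?thesis using fin card_mono[of ?I B] by (simp add: card_Diff_subset)
  qed
  ultimately have "card ?A + card B \<le> L * n + L * card S" using cC by simp
  then show ?thesis using cov fin by (intro that[of ?A B]) auto
qed

text \<open>Along the arcs, each unmarked vertex of level at least \<open>j\<close> has its right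
  copy of layer \<open>j\<close> in \<open>B\<close>. Being unmarked, it then has its left copy
  outside \<open>A\<close>, and the cover pushes the next right copy into \<open>B\<close>. A level
  above \<open>L\<close> would reach a sink in this way and mark its tail.\<close>

lemma feasible_cut_of:
  assumes "covers A B (layered L G col)"
  shows "feasible L G col (cut_of L n A B)"
proof -
  let ?S = "cut_of L n A B"
  let ?l = "level G col ?S"
  have cov: "r \<in> B" if "(l, r) \<in> layered L G col" "l \<notin> A" for l r
    using assms that by (auto simp: covers_def)
  have sub: "?S \<subseteq> verts G"
    by (cases "n = 0") (auto simp: cut_of_def in_verts_iff)
  have cut: "v \<in> ?S" if "v < n" "j < L + 2" "j = 0 \<or> v + j * n \<in> B" "j = Suc L \<or> v + j * n \<in> A" for v j
    unfolding cut_of_def using that layer_less[of v j "L + 2"]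
    by (intro image_eqI[of _ _ "v + j * n"]) auto
  have "?l v \<le> L \<and> (v \<notin> ?S \<longrightarrow> (\<forall>j\<in>{1..L}. j \<le> ?l v \<longrightarrow> v + j * n \<in> B))" if "v \<in> verts G" for v
    using that
  proof (induction v rule: arc_induct)
    case (step v)
    have v: "v < n" using step.hyps in_verts_iff by blast
    have left: "tail G e + j * n \<notin> A"
      if "e \<in> arcs G" "head G e = v" "tail G e \<notin> ?S" "j \<in> {1..L}" "j \<le> ?l (tail G e)" for e j
    proof -
      have "tail G e + j * n \<in> B" using step.IH[OF that(1,2)] that(3-5) by blast
      then show ?thesis using cut[of "tail G e" j] tail_less[OF that(1)] that(3,4) by auto
    qed
    have pred: "?l v \<le> red v \<or> (\<exists>e. e \<in> arcs G \<and> head G e = v \<and> tail G e \<notin> ?S \<and>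
        ?l v = ?l (tail G e) + red v)"
      using level_pred[OF step.hyps, of ?S] by (metis linorder_not_less)
    have "?l v \<le> L"
    proof (rule ccontr)
      assume big: "\<not> ?l v \<le> L"
      then have "\<not> ?l v \<le> red v" using L_pos by auto
      with pred obtain e where e: "e \<in> arcs G" "head G e = v" "tail G e \<notin> ?S"
        "?l v = ?l (tail G e) + red v" by blast
      have "?l (tail G e) \<le> L" using step.IH[OF e(1,2)] by blast
      with e(4) big have r: "col v = Red" and lt: "?l (tail G e) = L" by (auto split: if_splits)
      have "tail G e + L * n \<notin> A" using left[OF e(1-3), of L] lt L_pos by simp
      \<comment> \<open>\<open>arc_edge\<close> with index \<open>j\<close> leaves layer
        \<open>Suc j\<close>, so the last layer has index \<open>L - 1\<close>. The sink belongs to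
        the tail because marking the tail, not the head, lowers the level of the head.\<close>
      moreover have "(tail G e + L * n, tail G e + Suc L * n) \<in> layered L G col"
        using arc_edge_layered[OF e(1), of "L - 1"] r e(2) L_pos
        by (auto simp: arc_edge_def Let_def algebra_simps)
      ultimately have "tail G e + Suc L * n \<in> B" using cov by blast
      then have "tail G e \<in> ?S" using cut[of "tail G e" "Suc L"] tail_less[OF e(1)] by simp
      with e(3) show False by blast
    qed
    moreover have "v + j * n \<in> B" if vS: "v \<notin> ?S" and j: "j \<in> {1..L}" "j \<le> ?l v" for j
    proof (cases "?l v \<le> red v")
      case True
      with j have r: "col v = Red" and j1: "j = 1" by (auto split: if_splits)
      \<comment> \<open>In layer 0, membership in \<open>A\<close> alone would cut
        \<open>v\<close>.\<close>
      have "v \<notin> A" using cut[of v 0] v vS by auto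
      then show ?thesis using cov source_edge[OF v r] j1 by (simp add: add.commute)
    next
      case False
      with pred obtain e where e: "e \<in> arcs G" "head G e = v" "tail G e \<notin> ?S"
        "?l v = ?l (tail G e) + red v" by blast
      show ?thesis
      proof (cases "col v = Red \<and> j = 1")
        case True
        have "v \<notin> A" using cut[of v 0] v vS by auto
        then show ?thesis using cov source_edge[OF v] True by (simp add: add.commute)
      next
        case False
        \<comment> \<open>The arc into \<open>v\<close> leaves layer \<open>Suc i\<close>. The
          subtraction is exact, since a red \<open>v\<close> with \<open>j = 1\<close> was settled
          by its source edge.\<close>
        define i where "i = j - 1 - red v"
        have i: "j = Suc i + red v" "i < L" using False j by (auto simp: i_def split: if_splits)
        have "tail G e + Suc i * n \<notin> A" using left[OF e(1-3), of "Suc i"] e(4) i j by auto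
        moreover have "(tail G e + Suc i * n, v + j * n) \<in> layered L G col"
          using arc_edge_layered[OF e(1) i(2)] e(2) i j
          by (auto simp: arc_edge_def Let_def algebra_simps split: if_splits)
        ultimately show ?thesis using cov by blast
      qed
    qed
    ultimately show ?case by blast
  qed
  then show ?thesis using sub by (auto simp: feasible_def)
qed

text \<open>Split edges force every inner node into \<open>A\<close> or \<open>B\<close>, so
  \<open>card A + card B\<close> counts all \<open>L * n\<close> of them, and those in both sets
  once more. This excess plus the chosen sources and sinks bounds the cut, as projection can only
  merge nodes.\<close>

lemma card_cut_of:
  assumes "covers A B (layered L G col)" and "finite A" "finite B"
  shows "L * n + card (cut_of L n A B) \<le> card A + card B"
proof -
  let ?I = "{n..<Suc L * n}"
  let ?X = "{i. i < (L + 2) * n \<and> (i < n \<or> i \<in> B) \<and> (Suc L * n \<le> i \<or> i \<in> A)}"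
  let ?s = "A \<inter> {..<n}" and ?t = "B \<inter> {Suc L * n..}"
  have "?I \<subseteq> A \<union> B" using assms(1) split_edge by (fastforce simp: covers_def)
  then have "(A \<inter> ?I) \<union> (B \<inter> ?I) = ?I" by blast
  then have "card (A \<inter> ?I) + card (B \<inter> ?I) = card ?I + card ((A \<inter> ?I) \<inter> (B \<inter> ?I))"
    using card_Un_Int[of "A \<inter> ?I" "B \<inter> ?I"] by simp
  moreover have "card (cut_of L n A B) \<le> card ?X"
    unfolding cut_of_def by (intro card_image_le) auto
  moreover have "card ?X \<le> card (?s \<union> ((A \<inter> ?I) \<inter> (B \<inter> ?I)) \<union> ?t)"
    using assms(2,3) by (intro card_mono) auto
  moreover have "card (?s \<union> ((A \<inter> ?I) \<inter> (B \<inter> ?I)) \<union> ?t) \<le> card ?s + card ((A \<inter> ?I) \<inter> (B \<inter> ?I)) + card ?t"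
    by (meson add_le_mono card_Un_le le_refl le_trans)
  moreover have "card ?s + card (A \<inter> ?I) \<le> card A"
    using assms(2) by (subst card_Un_disjoint[symmetric]) (auto intro: card_mono)
  moreover have "card ?t + card (B \<inter> ?I) \<le> card B"
    using assms(3) by (subst card_Un_disjoint[symmetric]) (auto intro: card_mono)
  ultimately show ?thesis by simp
qed

end

section \<open>The program\<close>

notation Seq (infixr ";;" 55)

definition push :: "aexp \<Rightarrow> aexp \<Rightarrow> com" where
  "push a b = Store ''EL'' (V ''k'') a ;; Store ''ER'' (V ''k'') b ;; Inc ''k''"

definition edges :: "state \<Rightarrow> (nat \<times> nat) set" where
  "edges s = (\<lambda>i. (snd s ''EL'' i, snd s ''ER'' i)) ` {..<fst s ''k''}"

definition push_arc :: com where
  "push_arc =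
     (let u = Load ''tail'' (V ''e''); v = Load ''head'' (V ''e''); b = V ''b''; b' = Plus b (V ''n'') in
      If (Less (Load ''col'' v) (N 2)) (push (Plus b u) (Plus b v))
        (If (Less (Plus (V ''j'') (N 1)) (V ''L'')) (push (Plus b u) (Plus b' v))
          (push (Plus b u) (Plus b' u))))"

text \<open>\<open>b\<close> is the offset of the current layer, kept by addition in place of
  multiplication. \<open>R\<close> is the number of node addresses, and the price cap
  \<open>K = R + 2\<close> exceeds every candidate gap in \<open>1, ..., R + 1\<close>.\<close>

definition build :: com where
  "build =
     For ''i'' ''n'' (If (Less (N 1) (Load ''col'' (V ''i'')))
       (push (V ''i'') (Plus (V ''n'') (V ''i''))) Skip) ;;
     Assign ''b'' (V ''n'') ;;
     For ''j'' ''L''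
       (For ''i'' ''n'' (push (Plus (V ''b'') (V ''i'')) (Plus (V ''b'') (V ''i''))) ;;
        For ''e'' ''m'' push_arc ;;
        Assign ''b'' (Plus (V ''b'') (V ''n''))) ;;
     Assign ''R'' (Plus (V ''b'') (V ''n'')) ;;
     Assign ''K'' (Plus (V ''R'') (N 2))"

text \<open>A pass looks for the cheapest right node next to any unmatched left node.
  \<open>best\<close> starts at the cap, so ending at \<open>K\<close> means that none is below it;
  only otherwise is \<open>arg\<close> meaningful.\<close>

definition scan_edge :: com where
  "scan_edge =
     (let p = Load ''p'' (Load ''ER'' (V ''e'')) in
      If (And (Not (Less (N 0) (Load ''q'' (Load ''EL'' (V ''e''))))) (Less p (V ''best'')))
        (Assign ''best'' p ;; Assign ''arg'' (V ''e'')) Skip)"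

definition bid :: com where
  "bid =
     Assign ''l'' (Load ''EL'' (V ''arg'')) ;;
     Assign ''r'' (Load ''ER'' (V ''arg'')) ;;
     If (Less (N 0) (Load ''p'' (V ''r''))) (Store ''q'' (Load ''own'' (V ''r'')) (N 0)) Skip ;;
     Store ''own'' (V ''r'') (V ''l'') ;;
     Store ''p'' (V ''r'') (Plus (V ''best'') (N 1)) ;;
     Store ''q'' (V ''l'') (Plus (V ''best'') (N 1))"

definition run_auction :: com where
  "run_auction =
     While (Less (V ''best'') (V ''K''))
       (Assign ''best'' (V ''K'') ;; For ''e'' ''k'' scan_edge ;;
        If (Less (V ''best'') (V ''K'')) bid Skip)"

definition find_gap :: com where
  "find_gap =
     For ''i'' ''R'' (Store ''used'' (Load ''p'' (V ''i'')) (N 1)) ;;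
     Assign ''t'' (N 1) ;;
     While (Less (N 0) (Load ''used'' (V ''t''))) (Inc ''t'')"

text \<open>The counter \<open>v\<close> wraps around at \<open>n\<close> and so follows
  \<open>i mod n\<close> without division. The nested negations spell the two disjunctions of
  \<open>cut_of\<close>, with \<open>b\<close> equal to \<open>Suc L * n\<close>.\<close>

definition mark_node :: com where
  "mark_node =
     (let p = Load ''p'' (V ''i''); q = Load ''q'' (V ''i''); t = V ''t'' in
      If (And (Not (And (Not (Less (V ''i'') (V ''n''))) (Not (Less t p))))
              (Not (And (Less (V ''i'') (V ''b'')) (Not (And (Less (N 0) q) (Less q t))))))
        (Store ''S'' (V ''v'') (N 1)) Skip ;;
      Inc ''v'' ;;
      If (Less (V ''v'') (V ''n'')) Skip (Assign ''v'' (N 0)))"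

definition bootstrap :: com where
  "bootstrap =
     If (Less (V ''L'') (V ''n''))
       (build ;; run_auction ;; find_gap ;; For ''i'' ''R'' mark_node) Skip"

lemma push_simps [simp]:
  "wvars (push a b) = {''k''}" "warrs (push a b) = {''EL'', ''ER''}"
  "loop_free (push a b)" "ccost (push a b) = acost a + acost b + 10"
  by (auto simp: push_def)

lemma fst_push [simp]: "fst (effect (push a b) s) = (fst s)(''k'' := Suc (fst s ''k''))"
  and snd_push [simp]: "A \<noteq> ''EL'' \<Longrightarrow> A \<noteq> ''ER'' \<Longrightarrow> snd (effect (push a b) s) A = snd s A"
  by (auto simp: push_def)

lemma scan_edge_simps [simp]:
  "wvars scan_edge = {''best'', ''arg''}" "warrs scan_edge = {}" "loop_free scan_edge"
  by (auto simp: scan_edge_def Let_def)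

lemma bid_simps [simp]:
  "wvars bid = {''l'', ''r''}" "warrs bid = {''own'', ''p'', ''q''}" "loop_free bid"
  by (auto simp: bid_def)

text \<open>The right expression is evaluated after \<open>EL\<close> has been written, hence the
  \<open>store\<close> inside.\<close>

lemma edges_push [simp]:
  "edges (effect (push a b) s) =
    insert (aval a s, aval b (store ''EL'' (fst s ''k'') (aval a s) s)) (edges s)"
  by (auto simp: push_def edges_def lessThan_Suc image_iff less_Suc_eq)

lemma edges_assign [simp]: "x \<noteq> ''k'' \<Longrightarrow> edges (assign x c s) = edges s"
  by (simp add: edges_def)

lemma edges_cong:
  "fst s' ''k'' = fst s ''k'' \<Longrightarrow> snd s' ''EL'' = snd s ''EL'' \<Longrightarrow> snd s' ''ER'' = snd s ''ER'' \<Longrightarrow>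
    edges s' = edges s"
  by (simp add: edges_def)


section \<open>Correctness of the matching and the gap search\<close>

lemma sum_fun_upd_Suc:
  fixes f :: "'a \<Rightarrow> nat"
  assumes "finite A" and "x \<in> A"
  shows "sum (f(x := Suc (f x))) A = Suc (sum f A)"
proof -
  have "sum (f(x := Suc (f x))) (A - {x}) = sum f (A - {x})" by (intro sum.cong) auto
  then show ?thesis using assms by (simp add: sum.remove)
qed

lemma runs_scan:
  assumes "fst s ''k'' = k" and "fst s ''best'' = K"
  shows "runs (For ''e'' ''k'' scan_edge) s (k * 40 + 7) (\<lambda>s'.
    fst s' ''best'' \<le> K \<and>
    (\<forall>(l, r)\<in>edges s. snd s ''q'' l = 0 \<longrightarrow> fst s' ''best'' \<le> snd s ''p'' r) \<and>
    (fst s' ''best'' < K \<longrightarrow> (\<exists>i<k. i = fst s' ''arg'' \<and>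
      snd s ''q'' (snd s ''EL'' i) = 0 \<and> snd s ''p'' (snd s ''ER'' i) = fst s' ''best'')))"
proof -
  define I where "I i s' \<longleftrightarrow>
    fst s' ''best'' \<le> K \<and>
    (\<forall>j<i. snd s ''q'' (snd s ''EL'' j) = 0 \<longrightarrow> fst s' ''best'' \<le> snd s ''p'' (snd s ''ER'' j)) \<and>
    (fst s' ''best'' < K \<longrightarrow> fst s' ''arg'' < k \<and>
      snd s ''q'' (snd s ''EL'' (fst s' ''arg'')) = 0 \<and>
      snd s ''p'' (snd s ''ER'' (fst s' ''arg'')) = fst s' ''best'')" for i :: nat and s' :: state
  have "runs (For ''e'' ''k'' scan_edge) s (k * (ccost scan_edge + 9) + 7) (I k)"
  proof (rule runs_For)
    show "I 0 (assign ''e'' 0 s)" using assms by (auto simp: I_def)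
  next
    fix i s' assume i: "i < k" "fst s' ''e'' = i" and f: "frame (For ''e'' ''k'' scan_edge) s s'"
      and inv: "I i s'"
    have eq: "snd s' A = snd s A" for A
      using f by (auto simp: frame_def scan_edge_def Let_def)
    show "runs scan_edge s' (ccost scan_edge) (\<lambda>s''. I (Suc i) (assign ''e'' (Suc i) s''))"
      by (rule runs_effect)
        (use i inv in \<open>auto simp: scan_edge_def Let_def I_def eq less_Suc_eq\<close>)
  qed (use assms in \<open>auto simp: scan_edge_def Let_def\<close>)
  then show ?thesis
    by (rule runs_weaken) (use assms(1) in \<open>auto simp: I_def edges_def scan_edge_def Let_def\<close>)
qed

lemma effect_bid:
  assumes "fst s ''arg'' = i" and "snd s ''EL'' i = l" and "snd s ''ER'' i = r"
    and "snd s ''p'' r = fst s ''best''"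
  shows "snd (effect bid s) ''p'' = (snd s ''p'')(r := Suc (snd s ''p'' r))"
    and "snd (effect bid s) ''own'' = (snd s ''own'')(r := l)"
    and "snd (effect bid s) ''q'' =
      (if snd s ''p'' r > 0 then (snd s ''q'')(snd s ''own'' r := 0) else snd s ''q'')(l := Suc (snd s ''p'' r))"
    and "fst (effect bid s) ''best'' = fst s ''best''"
  using assms by (auto simp: bid_def)

text \<open>Only nodes below \<open>R\<close> receive bids and no price passes \<open>K\<close>, so
  there are at most \<open>R * K\<close> bids, plus one round that finds nothing to bid for.\<close>

lemma runs_auction:
  assumes bound: "\<And>l r. (l, r) \<in> edges s \<Longrightarrow> r < R"
    and init: "snd s ''p'' = (\<lambda>_. 0)" "snd s ''q'' = (\<lambda>_. 0)"
      "fst s ''best'' = 0" "fst s ''K'' = K" "K > 0" "fst s ''k'' = k"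
  shows "runs run_auction s ((R * K + 1) * (k * 40 + 100) + 10) (\<lambda>s'.
    auction (edges s) (snd s' ''p'') (snd s' ''q'') (snd s' ''own'') \<and>
    (\<forall>(l, r)\<in>edges s. snd s' ''q'' l = 0 \<longrightarrow> K \<le> snd s' ''p'' r))"
proof -
  let ?E = "edges s"
  let ?scan = "For ''e'' ''k'' scan_edge"
  let ?if = "If (Less (V ''best'') (V ''K'')) bid Skip"
  let ?body = "Assign ''best'' (V ''K'') ;; ?scan ;; ?if"
  let ?free = "\<lambda>s'. \<forall>(l, r)\<in>?E. snd s' ''q'' l = 0 \<longrightarrow> K \<le> snd s' ''p'' r"
  define A where "A s' \<longleftrightarrow> auction ?E (snd s' ''p'') (snd s' ''q'') (snd s' ''own'') \<and>
    (\<forall>r. snd s' ''p'' r \<le> K)" for s' :: state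
  define I where "I s' \<longleftrightarrow> A s' \<and> (K \<le> fst s' ''best'' \<longrightarrow> ?free s')" for s'
  \<comment> \<open>The unspent price range, plus one unit for the closing round, in which
    \<open>best\<close> reaches \<open>K\<close> while prices stay put.\<close>
  define \<mu> where "\<mu> s' = R * K - (\<Sum>r<R. snd s' ''p'' r) + (if fst s' ''best'' < K then 1 else 0)"
    for s' :: state
  have "runs run_auction s (\<mu> s * ((k * 40 + 80) + bcost (Less (V ''best'') (V ''K'')) + 1)
      + bcost (Less (V ''best'') (V ''K'')) + 1)
    (\<lambda>s'. (I s' \<and> \<not> bval (Less (V ''best'') (V ''K'')) s') \<and> frame run_auction s s')"
    unfolding run_auction_def
  proof (rule runs_frame, rule runs_While)
    show "I s" using init by (auto simp: I_def A_def auction_empty)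
  next
    fix s1 assume I1: "I s1" and f1: "frame ?body s s1" and b1: "bval (Less (V ''best'') (V ''K'')) s1"
    have s1: "fst s1 ''K'' = K" "fst s1 ''k'' = k" "snd s1 ''EL'' = snd s ''EL''"
      "snd s1 ''ER'' = snd s ''ER''"
      by (simp_all add: frame_fst[OF f1] frame_snd[OF f1] init)
    then have E1: "edges s1 = ?E" by (intro edges_cong) (simp_all add: init)
    have best1: "fst s1 ''best'' < K" using b1 s1 by simp
    have inv1: "A s1" using I1 by (simp add: I_def)
    show "runs ?body s1 (k * 40 + 80) (\<lambda>s'. I s' \<and> \<mu> s' < \<mu> s1)"
    proof (rule runs_weaken[OF runs_Seq[where Q = "\<lambda>s'. s' = assign ''best'' K s1" and T = 2]])
      show "runs (Assign ''best'' (V ''K'')) s1 2 (\<lambda>s'. s' = assign ''best'' K s1)"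
        using runs_Assign[of "V ''K''" 2 "''best''" s1] s1(1) by simp
    next
      fix s2 assume s2: "s2 = assign ''best'' K s1"
      show "runs (?scan ;; ?if) s2 ((k * 40 + 7) + 66 + 1) (\<lambda>s'. I s' \<and> \<mu> s' < \<mu> s1)"
      proof (rule runs_Seq[OF runs_scan])
        show "fst s2 ''k'' = k" "fst s2 ''best'' = K" using s1 s2 by auto
      next
        fix s3 assume f3: "frame ?scan s2 s3"
          and post: "fst s3 ''best'' \<le> K \<and>
            (\<forall>(l, r)\<in>edges s2. snd s2 ''q'' l = 0 \<longrightarrow> fst s3 ''best'' \<le> snd s2 ''p'' r) \<and>
            (fst s3 ''best'' < K \<longrightarrow> (\<exists>i<k. i = fst s3 ''arg'' \<and>
              snd s2 ''q'' (snd s2 ''EL'' i) = 0 \<and> snd s2 ''p'' (snd s2 ''ER'' i) = fst s3 ''best''))"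
        have s3: "fst s3 ''K'' = K" "snd s3 = snd s1"
          using s1 s2 by (auto simp: frame_fst[OF f3] frame_snd[OF f3])
        have E2: "edges s2 = ?E" using E1 s2 by simp
        have "I (effect ?if s3) \<and> \<mu> (effect ?if s3) < \<mu> s1"
        proof (cases "fst s3 ''best'' < K")
          case False
          then have "?free s3" using post s3 s2 E2 by fastforce
          moreover have "A s3" using inv1 s3 by (simp add: A_def)
          ultimately show ?thesis using False s3 best1 by (simp add: I_def \<mu>_def)
        next
          case True
          define i where "i = fst s3 ''arg''"
          define l r where "l = snd s1 ''EL'' i" and "r = snd s1 ''ER'' i"
          define p where "p = snd s1 ''p''"
          have i: "i < k" "snd s1 ''q'' l = 0" "p r = fst s3 ''best''"
            using post True s2 by (auto simp: i_def l_def r_def p_def)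
          have "(l, r) \<in> edges s1" using i(1) s1(2) by (auto simp: edges_def l_def r_def)
          then have lr: "(l, r) \<in> ?E" by (simp only: E1)
          \<comment> \<open>The scan minimises over all edges with an unmatched left end, in
            particular over those at \<open>l\<close>.\<close>
          have least: "p r \<le> p r'" if "(l, r') \<in> ?E" for r'
            using post that E2 s2 i(2,3) unfolding p_def by auto
          let ?s = "effect bid s3"
          have "snd s3 ''EL'' i = l" "snd s3 ''ER'' i = r" "snd s3 ''p'' r = fst s3 ''best''"
            using i(3) by (simp_all add: s3(2) l_def r_def p_def)
          note bid = effect_bid[OF i_def[symmetric] this, unfolded s3(2), folded p_def]
          have s: "snd ?s ''p'' = p(r := Suc (p r))" "fst ?s ''best'' < K"
            using bid(1,4) True by simp_all
          have "auction ?E p (snd s1 ''q'') (snd s1 ''own'')"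
            using inv1 by (simp add: A_def p_def)
          then have auc: "auction ?E (snd ?s ''p'') (snd ?s ''q'') (snd ?s ''own'')"
            unfolding bid(1-3) using lr i(2) least by (rule auction_bid)
          have le: "\<forall>r'. snd ?s ''p'' r' \<le> K"
            using inv1 True i(3) by (auto simp: A_def s p_def)
          have "(\<Sum>r<R. snd ?s ''p'' r) = Suc (\<Sum>r<R. p r)"
            unfolding s using bound[OF lr] by (intro sum_fun_upd_Suc) auto
          moreover have "(\<Sum>r<R. snd ?s ''p'' r) \<le> R * K"
            using sum_bounded_above[of "{..<R}" "snd ?s ''p''" K] le by simp
          ultimately have "\<mu> ?s < \<mu> s1" using s best1 by (simp add: \<mu>_def p_def)
          then show ?thesis using auc le s True s3 by (simp add: I_def A_def)
        qed
        then have "runs ?if s3 (ccost ?if) (\<lambda>s'. I s' \<and> \<mu> s' < \<mu> s1)"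
          by (intro runs_effect) (auto simp: bid_def)
        then show "runs ?if s3 66 (\<lambda>s'. I s' \<and> \<mu> s' < \<mu> s1)"
          by (rule runs_weaken) (auto simp: bid_def)
      qed
    qed auto
  qed
  moreover have "\<mu> s = R * K + 1" using init by (simp add: \<mu>_def)
  ultimately show ?thesis
  proof (elim runs_weaken)
    fix s' assume s': "(I s' \<and> \<not> bval (Less (V ''best'') (V ''K'')) s') \<and> frame run_auction s s'"
    then have "fst s' ''K'' = K" using init(4) frame_fst[of run_auction s s' "''K''"] by (simp add: run_auction_def)
    with s' show "auction ?E (snd s' ''p'') (snd s' ''q'') (snd s' ''own'') \<and> ?free s'"
      by (simp add: I_def A_def)
  qed (simp add: algebra_simps)
qed

text \<open>Pigeonhole: \<open>R\<close> prices cannot exhaust \<open>1, ..., R + 1\<close>. The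
  search starts at 1 because price 0 stands for unmatched nodes.\<close>

lemma runs_find_gap:
  assumes "fst s ''R'' = R" and "snd s ''used'' = (\<lambda>_. 0)"
  shows "runs find_gap s (R * 30 + 50) (\<lambda>s'.
    0 < fst s' ''t'' \<and> fst s' ''t'' \<le> R + 1 \<and> fst s' ''t'' \<notin> snd s ''p'' ` {..<R})"
proof -
  let ?P = "snd s ''p'' ` {..<R}"
  let ?while = "While (Less (N 0) (Load ''used'' (V ''t''))) (Inc ''t'')"
  let ?body = "Store ''used'' (Load ''p'' (V ''i'')) (N 1)"
  define U where "U i s' \<longleftrightarrow> (\<forall>x. snd s' ''used'' x > 0 \<longleftrightarrow> x \<in> snd s ''p'' ` {..<i})"
    for i :: nat and s' :: state
  have "runs (For ''i'' ''R'' ?body) s (R * (ccost ?body + 9) + 7) (U R)"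
  proof (rule runs_For)
    fix i s' assume i: "i < R" "fst s' ''i'' = i" and f: "frame (For ''i'' ''R'' ?body) s s'"
      and inv: "U i s'"
    have "snd s' ''p'' = snd s ''p''" using f by (simp add: frame_def)
    then show "runs ?body s' (ccost ?body) (\<lambda>s''. U (Suc i) (assign ''i'' (Suc i) s''))"
      by (intro runs_effect) (use i inv in \<open>auto simp: U_def lessThan_Suc\<close>)
  qed (use assms in \<open>auto simp: U_def\<close>)
  then have 1: "runs (For ''i'' ''R'' ?body) s (R * 13 + 7) (U R)"
    by (simp add: numeral_eq_Suc)
  have 2: "runs (Assign ''t'' (N 1)) s' 2 (\<lambda>s''. s'' = assign ''t'' 1 s')" for s'
    using runs_Assign[of "N 1" 2 "''t''" s'] by simp
  have 3: "runs ?while s' (R * 10 + 20) (\<lambda>s''. 0 < fst s'' ''t'' \<and> fst s'' ''t'' \<le> R + 1 \<and> fst s'' ''t'' \<notin> ?P)"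
    if U: "U R s'" and t: "fst s' ''t'' = 1" for s'
  proof -
    define I where "I s'' \<longleftrightarrow> 0 < fst s'' ''t'' \<and> fst s'' ''t'' \<le> R + 1 \<and> {1..<fst s'' ''t''} \<subseteq> ?P \<and> U R s''" for s''
    have "runs ?while s' ((R + 2 - fst s' ''t'') * (4 + bcost (Less (N 0) (Load ''used'' (V ''t''))) + 1)
        + bcost (Less (N 0) (Load ''used'' (V ''t''))) + 1)
      (\<lambda>s''. I s'' \<and> \<not> bval (Less (N 0) (Load ''used'' (V ''t''))) s'')"
    proof (rule runs_While)
      show "I s'" using U t by (simp add: I_def)
    next
      fix s1 assume inv: "I s1" and b: "bval (Less (N 0) (Load ''used'' (V ''t''))) s1"
      have "fst s1 ''t'' \<in> ?P" using inv b by (auto simp: I_def U_def)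
      moreover have "{1..<Suc (fst s1 ''t'')} \<subseteq> insert (fst s1 ''t'') {1..<fst s1 ''t''}" by auto
      ultimately have sub: "{1..<Suc (fst s1 ''t'')} \<subseteq> ?P"
        using inv unfolding I_def by blast
      then have "card {1..<Suc (fst s1 ''t'')} \<le> card {..<R}"
        by (intro surj_card_le) auto
      then have "fst s1 ''t'' \<le> R" by simp
      then have "runs (Inc ''t'') s1 (ccost (Inc ''t''))
        (\<lambda>s2. I s2 \<and> R + 2 - fst s2 ''t'' < R + 2 - fst s1 ''t'')"
        using inv sub by (intro runs_effect) (auto simp: I_def U_def)
      then show "runs (Inc ''t'') s1 4 (\<lambda>s2. I s2 \<and> R + 2 - fst s2 ''t'' < R + 2 - fst s1 ''t'')"
        by (simp add: numeral_eq_Suc)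
    qed
    then show ?thesis
    proof (rule runs_weaken)
      fix s'' assume s'': "I s'' \<and> \<not> bval (Less (N 0) (Load ''used'' (V ''t''))) s''"
      then have "0 < snd s'' ''used'' (fst s'' ''t'') \<longleftrightarrow> fst s'' ''t'' \<in> ?P"
        unfolding I_def U_def by blast
      with s'' show "0 < fst s'' ''t'' \<and> fst s'' ''t'' \<le> R + 1 \<and> fst s'' ''t'' \<notin> ?P"
        by (simp add: I_def)
    qed (use t in auto)
  qed
  have "runs find_gap s ((R * 13 + 7) + (2 + (R * 10 + 20) + 1) + 1) (\<lambda>s'.
    0 < fst s' ''t'' \<and> fst s' ''t'' \<le> R + 1 \<and> fst s' ''t'' \<notin> ?P)"
    unfolding find_gap_def
  proof (rule runs_Seq[OF 1], rule runs_Seq[OF 2], rule 3)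
    fix s1 s2 assume "U R s1" "s2 = assign ''t'' 1 s1"
    then show "U R s2" "fst s2 ''t'' = 1" by (auto simp: U_def)
  qed
  then show ?thesis by (rule runs_weaken) auto
qed

section \<open>Correctness of the construction and of the marking\<close>

context bootstrap_instance
begin

definition loaded :: "state \<Rightarrow> bool" where
  "loaded s \<longleftrightarrow> fst s ''n'' = n \<and> fst s ''m'' = m \<and> fst s ''L'' = L \<and>
     (\<forall>e<m. snd s ''tail'' e = tail G e \<and> snd s ''head'' e = head G e) \<and>
     (\<forall>v<n. snd s ''col'' v = colour_code (col v))"

lemma loaded_initial: "loaded (initial_state L G col)"
  by (auto simp: loaded_def initial_state_def in_verts_iff in_arcs_iff)

lemma loaded_frame:
  "loaded s \<Longrightarrow> frame c s s' \<Longrightarrow> {''n'', ''m'', ''L''} \<inter> wvars c = {} \<Longrightarrow>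
    {''tail'', ''head'', ''col''} \<inter> warrs c = {} \<Longrightarrow> loaded s'"
  by (simp add: loaded_def frame_def)

lemma colour_code_less: "colour_code c < 2 \<longleftrightarrow> c \<noteq> Red" "Suc 0 < colour_code c \<longleftrightarrow> c = Red"
  by (cases c; simp)+

lemma push_arc_simps [simp]:
  "wvars push_arc = {''k''}" "warrs push_arc = {''EL'', ''ER''}" "loop_free push_arc"
  "ccost push_arc \<le> 91"
  by (auto simp: push_arc_def Let_def)

lemma runs_sources:
  assumes "loaded s" and "fst s ''k'' = 0"
  shows "runs (For ''i'' ''n'' (If (Less (N 1) (Load ''col'' (V ''i'')))
      (push (V ''i'') (Plus (V ''n'') (V ''i''))) Skip)) s (n * 40 + 7)
    (\<lambda>s'. edges s' = (\<lambda>v. (v, n + v)) ` {v \<in> verts G. col v = Red} \<and> fst s' ''k'' \<le> n)"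
proof -
  let ?c = "If (Less (N 1) (Load ''col'' (V ''i''))) (push (V ''i'') (Plus (V ''n'') (V ''i''))) Skip"
  let ?red = "\<lambda>i. {v. v < i \<and> col v = Red}"
  have red_Suc: "?red (Suc i) = (if col i = Red then insert i (?red i) else ?red i)" for i
    by (auto simp: less_Suc_eq)
  have "runs (For ''i'' ''n'' ?c) s (n * (ccost ?c + 9) + 7)
    (\<lambda>s'. edges s' = (\<lambda>v. (v, n + v)) ` ?red n \<and> fst s' ''k'' \<le> n)"
  proof (rule runs_For[where I = "\<lambda>i s'. edges s' = (\<lambda>v. (v, n + v)) ` ?red i \<and> fst s' ''k'' \<le> i"])
    fix i s' assume i: "i < n" "fst s' ''i'' = i" and f: "frame (For ''i'' ''n'' ?c) s s'"
      and inv: "edges s' = (\<lambda>v. (v, n + v)) ` ?red i \<and> fst s' ''k'' \<le> i"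
    have "loaded s'" using loaded_frame[OF assms(1) f] by simp
    then show "runs ?c s' (ccost ?c) (\<lambda>s''. edges (assign ''i'' (Suc i) s'') = (\<lambda>v. (v, n + v)) ` ?red (Suc i) \<and>
        fst (assign ''i'' (Suc i) s'') ''k'' \<le> Suc i)"
      by (intro runs_effect) (use i inv in \<open>auto simp: loaded_def red_Suc colour_code_less\<close>)
  qed (use assms in \<open>auto simp: loaded_def edges_def\<close>)
  then show ?thesis by (rule runs_weaken) (auto simp: in_verts_iff)
qed

lemma runs_splits:
  assumes "fst s ''n'' = n" and "fst s ''b'' = b" and "fst s ''k'' = k"
  shows "runs (For ''i'' ''n'' (push (Plus (V ''b'') (V ''i'')) (Plus (V ''b'') (V ''i'')))) s (n * 40 + 7)
    (\<lambda>s'. edges s' = edges s \<union> Id_on {b..<b + n} \<and> fst s' ''k'' = k + n)"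
proof -
  let ?c = "push (Plus (V ''b'') (V ''i'')) (Plus (V ''b'') (V ''i''))"
  have "runs (For ''i'' ''n'' ?c) s (n * (ccost ?c + 9) + 7)
    (\<lambda>s'. edges s' = edges s \<union> Id_on {b..<b + n} \<and> fst s' ''k'' = k + n)"
  proof (rule runs_For)
    fix i s' assume i: "i < n" "fst s' ''i'' = i" and f: "frame (For ''i'' ''n'' ?c) s s'"
      and inv: "edges s' = edges s \<union> Id_on {b..<b + i} \<and> fst s' ''k'' = k + i"
    have "fst s' ''b'' = b" using f assms by (simp add: frame_def)
    then show "runs ?c s' (ccost ?c) (\<lambda>s''.
        edges (assign ''i'' (Suc i) s'') = edges s \<union> Id_on {b..<b + Suc i} \<and>
        fst (assign ''i'' (Suc i) s'') ''k'' = k + Suc i)"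
      by (intro runs_effect) (use i inv in \<open>auto simp: Id_on_def less_Suc_eq\<close>)
  qed (use assms in auto)
  then show ?thesis by (rule runs_weaken) auto
qed

lemma runs_arcs:
  assumes "loaded s" and "fst s ''b'' = Suc j * n" and "fst s ''j'' = j" and "fst s ''k'' = k"
  shows "runs (For ''e'' ''m'' push_arc) s (m * 100 + 7)
    (\<lambda>s'. edges s' = edges s \<union> arc_edge L G col j ` arcs G \<and> fst s' ''k'' = k + m)"
proof -
  have "runs (For ''e'' ''m'' push_arc) s (m * (ccost push_arc + 9) + 7)
    (\<lambda>s'. edges s' = edges s \<union> arc_edge L G col j ` {..<m} \<and> fst s' ''k'' = k + m)"
  proof (rule runs_For)
    fix e s' assume e: "e < m" "fst s' ''e'' = e" and f: "frame (For ''e'' ''m'' push_arc) s s'"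
      and inv: "edges s' = edges s \<union> arc_edge L G col j ` {..<e} \<and> fst s' ''k'' = k + e"
    have "loaded s'" using loaded_frame[OF assms(1) f] by simp
    moreover have "fst s' ''b'' = Suc j * n" "fst s' ''j'' = j"
      using f assms by (simp_all add: frame_def)
    moreover have "head G e < n" using e head_less in_arcs_iff by blast
    ultimately show "runs push_arc s' (ccost push_arc) (\<lambda>s''.
        edges (assign ''e'' (Suc e) s'') = edges s \<union> arc_edge L G col j ` {..<Suc e} \<and>
        fst (assign ''e'' (Suc e) s'') ''k'' = k + Suc e)"
      by (intro runs_effect)
        (use e inv in \<open>auto simp: push_arc_def Let_def loaded_def arc_edge_def lessThan_Suc colour_code_less\<close>)
  qed (use assms in \<open>auto simp: loaded_def\<close>)
  then show ?thesis
    using mult_le_mono2[of "ccost push_arc + 9" 100 m]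
    by (elim runs_weaken) (auto simp flip: arcs_eq)
qed

lemma runs_build:
  assumes "loaded s" and "fst s ''k'' = 0"
  shows "runs build s (n * 40 + L * (n * 40 + m * 100 + 50) + 50) (\<lambda>s'.
    edges s' = layered L G col \<and> fst s' ''k'' \<le> n + L * (n + m) \<and> fst s' ''b'' = Suc L * n \<and>
    fst s' ''R'' = (L + 2) * n \<and> fst s' ''K'' = (L + 2) * n + 2)"
proof -
  let ?src = "For ''i'' ''n'' (If (Less (N 1) (Load ''col'' (V ''i'')))
    (push (V ''i'') (Plus (V ''n'') (V ''i''))) Skip)"
  let ?split = "For ''i'' ''n'' (push (Plus (V ''b'') (V ''i'')) (Plus (V ''b'') (V ''i'')))"
  let ?arcs = "For ''e'' ''m'' push_arc"
  let ?next = "Assign ''b'' (Plus (V ''b'') (V ''n''))"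
  let ?layer = "?split ;; ?arcs ;; ?next"
  let ?ends = "Assign ''R'' (Plus (V ''b'') (V ''n'')) ;; Assign ''K'' (Plus (V ''R'') (N 2))"
  \<comment> \<open>The edges present after \<open>j\<close> rounds; at \<open>j = L\<close> this is
    \<open>layered\<close>. The offset is \<open>Suc j * n\<close> because layer 0 holds the
    sources.\<close>
  let ?E = "\<lambda>j. (\<lambda>v. (v, n + v)) ` {v \<in> verts G. col v = Red} \<union> Id_on {n..<Suc j * n} \<union>
    (\<Union>j<j. arc_edge L G col j ` arcs G)"
  let ?I = "\<lambda>j s. edges s = ?E j \<and> fst s ''k'' \<le> n + j * (n + m) \<and> fst s ''b'' = Suc j * n"
  have layer: "runs ?layer s1 (n * 40 + m * 100 + 30) (\<lambda>s2. ?I (Suc j) (assign ''j'' (Suc j) s2))"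
    if l1: "loaded s1" and j: "fst s1 ''j'' = j" and inv: "?I j s1" for j s1
  proof (rule runs_weaken[OF runs_Seq[OF runs_splits runs_Seq[OF runs_arcs runs_effect]]])
    show "fst s1 ''n'' = n" using l1 by (simp add: loaded_def)
    show "fst s1 ''b'' = Suc j * n" using inv by simp
  next
    fix s2 assume f: "frame ?split s1 s2"
    show "loaded s2" using loaded_frame[OF l1 f] by simp
    show "fst s2 ''b'' = Suc j * n" "fst s2 ''j'' = j" using f inv j by (auto simp: frame_def)
  next
    fix s2 s3
    assume 2: "edges s2 = edges s1 \<union> Id_on {Suc j * n..<Suc j * n + n} \<and> fst s2 ''k'' = fst s1 ''k'' + n"
        "frame ?split s1 s2"
      and 3: "edges s3 = edges s2 \<union> arc_edge L G col j ` arcs G \<and> fst s3 ''k'' = fst s2 ''k'' + m"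
        "frame ?arcs s2 s3"
    have "fst s3 ''b'' = Suc j * n" "fst s3 ''n'' = n"
      using 2(2) 3(2) inv l1 by (auto simp: frame_def loaded_def)
    moreover have "Id_on {n..<Suc j * n} \<union> Id_on {Suc j * n..<Suc j * n + n} = Id_on {n..<Suc (Suc j) * n}"
      by (auto simp: Id_on_def)
    ultimately show "?I (Suc j) (assign ''j'' (Suc j) (effect ?next s3))"
      using 2(1) 3(1) inv by (auto simp: lessThan_Suc)
  qed auto
  have layers: "runs (For ''j'' ''L'' ?layer) s1 (L * ((n * 40 + m * 100 + 30) + 9) + 7) (?I L)"
    if l1: "loaded s1" and inv: "?I 0 s1" for s1
  proof (rule runs_For[where I = ?I])
    show "runs ?layer s2 (n * 40 + m * 100 + 30) (\<lambda>s3. ?I (Suc j) (assign ''j'' (Suc j) s3))"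
      if "frame (For ''j'' ''L'' ?layer) s1 s2" "fst s2 ''j'' = j" "?I j s2" for j s2
      using layer that loaded_frame[OF l1 that(1)] by simp
  qed (use l1 inv in \<open>auto simp: loaded_def\<close>)
  show ?thesis
    unfolding build_def
  proof (rule runs_weaken[OF runs_Seq[OF runs_sources[OF assms] runs_Seq[where Q = "\<lambda>s2. loaded s2 \<and> ?I 0 s2"]]])
    fix s1 assume 1: "edges s1 = (\<lambda>v. (v, n + v)) ` {v \<in> verts G. col v = Red} \<and> fst s1 ''k'' \<le> n"
      "frame ?src s s1"
    have "loaded s1" using loaded_frame[OF assms(1) 1(2)] by simp
    with 1(1) show "runs (Assign ''b'' (V ''n'')) s1 (ccost (Assign ''b'' (V ''n''))) (\<lambda>s2. loaded s2 \<and> ?I 0 s2)"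
      by (intro runs_effect) (auto simp: loaded_def)
  next
    fix s2 assume 2: "loaded s2 \<and> ?I 0 s2"
    show "runs (For ''j'' ''L'' ?layer ;; ?ends) s2
      ((L * ((n * 40 + m * 100 + 30) + 9) + 7) + ccost ?ends + 1) (\<lambda>s'.
      edges s' = layered L G col \<and> fst s' ''k'' \<le> n + L * (n + m) \<and> fst s' ''b'' = Suc L * n \<and>
      fst s' ''R'' = (L + 2) * n \<and> fst s' ''K'' = (L + 2) * n + 2)"
    proof (rule runs_Seq[OF layers runs_effect])
      show "loaded s2" and "?I 0 s2" using 2 by blast+
    next
      fix s3 assume 3: "?I L s3" "frame (For ''j'' ''L'' ?layer) s2 s3"
      have "fst s3 ''n'' = n" using 3(2) 2 by (auto simp: frame_def loaded_def)
      with 3(1) show "edges (effect ?ends s3) = layered L G col \<and> fst (effect ?ends s3) ''k'' \<le> n + L * (n + m) \<and>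
        fst (effect ?ends s3) ''b'' = Suc L * n \<and> fst (effect ?ends s3) ''R'' = (L + 2) * n \<and>
        fst (effect ?ends s3) ''K'' = (L + 2) * n + 2"
        by (auto simp: layered_def)
    qed simp
  qed (auto simp: algebra_simps)
qed

lemma runs_mark:
  assumes "fst s ''n'' = n" "fst s ''b'' = Suc L * n" "fst s ''R'' = (L + 2) * n" "fst s ''v'' = 0"
    "snd s ''S'' = (\<lambda>_. 0)" and "n > 0"
  shows "runs (For ''i'' ''R'' mark_node) s ((L + 2) * n * 80 + 7) (\<lambda>s'.
    output_set G s' = cut_of L n {l. 0 < snd s ''q'' l \<and> snd s ''q'' l < fst s ''t''}
      {r. fst s ''t'' < snd s ''p'' r})"
proof -
  let ?A = "{l. 0 < snd s ''q'' l \<and> snd s ''q'' l < fst s ''t''}"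
  let ?B = "{r. fst s ''t'' < snd s ''p'' r}"
  \<comment> \<open>The cut nodes below \<open>i\<close>; at \<open>i = (L + 2) * n\<close> their
    projection is \<open>cut_of\<close>.\<close>
  define M where "M i = {i'. i' < i \<and> (i' < n \<or> i' \<in> ?B) \<and> (Suc L * n \<le> i' \<or> i' \<in> ?A)}" for i
  define I where "I i s' \<longleftrightarrow> fst s' ''v'' = i mod n \<and>
    (\<forall>v. snd s' ''S'' v > 0 \<longleftrightarrow> v \<in> (\<lambda>i. i mod n) ` M i)" for i :: nat and s' :: state
  have M_Suc: "M (Suc i) = (if (i < n \<or> i \<in> ?B) \<and> (Suc L * n \<le> i \<or> i \<in> ?A) then insert i (M i) else M i)" for i
    by (auto simp: M_def less_Suc_eq)
  have "runs (For ''i'' ''R'' mark_node) s ((L + 2) * n * (ccost mark_node + 9) + 7) (I ((L + 2) * n))"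
  proof (rule runs_For)
    show "I 0 (assign ''i'' 0 s)" using assms by (auto simp: I_def M_def)
  next
    fix i s' assume i: "fst s' ''i'' = i" and f: "frame (For ''i'' ''R'' mark_node) s s'" and inv: "I i s'"
    have eq: "fst s' ''n'' = n" "fst s' ''b'' = Suc L * n" "fst s' ''t'' = fst s ''t''"
      "snd s' ''p'' = snd s ''p''" "snd s' ''q'' = snd s ''q''"
      using f assms by (auto simp: frame_def mark_node_def Let_def)
    have less: "i mod n < n" using assms by simp
    show "runs mark_node s' (ccost mark_node) (\<lambda>s''. I (Suc i) (assign ''i'' (Suc i) s''))"
    proof (rule runs_effect)
      show "I (Suc i) (assign ''i'' (Suc i) (effect mark_node s'))"
        using inv eq i less unfolding I_def M_Suc
        by (auto simp: mark_node_def Let_def mod_Suc)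
    qed (simp add: mark_node_def Let_def)
  qed (use assms in \<open>auto simp: mark_node_def Let_def\<close>)
  then show ?thesis
  proof (rule runs_weaken)
    show "(L + 2) * n * (ccost mark_node + 9) + 7 \<le> (L + 2) * n * 80 + 7"
      using mult_le_mono2[of "ccost mark_node + 9" 80 "(L + 2) * n"]
      by (simp add: mark_node_def Let_def)
  next
    fix s' assume "I ((L + 2) * n) s'"
    then have "{v. snd s' ''S'' v > 0} = cut_of L n ?A ?B"
      by (auto simp: I_def M_def cut_of_def)
    moreover have "cut_of L n ?A ?B \<subseteq> verts G"
      using assms(6) by (auto simp: cut_of_def in_verts_iff)
    ultimately show "output_set G s' = cut_of L n ?A ?B"
      by (auto simp: output_set_def)
  qed
qed

end

text \<open>The type is general so that one expression serves both as a number and, at the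
  indeterminate, as a polynomial. It adds the bounds of the four phases and 20 for the glue;
  \<open>k\<close> bounds the number of edges.\<close>

definition time_bound :: "'a \<Rightarrow> 'a \<Rightarrow> 'a \<Rightarrow> 'a :: comm_semiring_1" where
  "time_bound n m L =
     (let R = (L + 2) * n; k = n + L * (n + m) in
      (n * 40 + L * (n * 40 + m * 100 + 50) + 50) + ((R * (R + 2) + 1) * (k * 40 + 100) + 10) +
      (R * 30 + 50) + (R * 80 + 7) + 20)"

section \<open>Correctness and running time of the whole program\<close>

context bootstrap_instance
begin

lemma runs_bootstrap:
  assumes "L < n"
  shows "runs bootstrap (initial_state L G col) (time_bound n m L)
    (\<lambda>s. feasible L G col (output_set G s) \<and> card (output_set G s) \<le> L * OPT L G col)"
proof -
  let ?R = "(L + 2) * n" and ?k = "n + L * (n + m)"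
  let ?s = "initial_state L G col"
  let ?E = "layered L G col"
  let ?mark = "For ''i'' ''R'' mark_node"
  note defs = build_def run_auction_def find_gap_def bid_def scan_edge_def Let_def
  have zero: "fst ?s x = 0" if "x \<notin> {''L'', ''n'', ''m''}" for x
    using that by (auto simp: initial_state_def)
  have zeroA: "snd ?s A = (\<lambda>_. 0)" if "A \<notin> {''tail'', ''head'', ''col''}" for A
    using that by (auto simp: initial_state_def)
  have "runs (build ;; run_auction ;; find_gap ;; ?mark) ?s
    ((n * 40 + L * (n * 40 + m * 100 + 50) + 50) +
     (((?R * (?R + 2) + 1) * (?k * 40 + 100) + 10) + ((?R * 30 + 50) + (?R * 80 + 7) + 1) + 1) + 1)
    (\<lambda>s. feasible L G col (output_set G s) \<and> card (output_set G s) \<le> L * OPT L G col)"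
  proof (rule runs_Seq[OF runs_build])
    show "loaded ?s" "fst ?s ''k'' = 0" by (simp_all add: loaded_initial zero)
  next
    fix s1 assume f1: "frame build ?s s1"
      and s1: "edges s1 = ?E \<and> fst s1 ''k'' \<le> ?k \<and> fst s1 ''b'' = Suc L * n \<and>
        fst s1 ''R'' = ?R \<and> fst s1 ''K'' = ?R + 2"
    have l1: "fst s1 ''n'' = n" using f1 loaded_initial by (auto simp: frame_def loaded_def defs)
    have z1: "fst s1 ''best'' = 0" "fst s1 ''v'' = 0" "snd s1 ''p'' = (\<lambda>_. 0)" "snd s1 ''q'' = (\<lambda>_. 0)"
        "snd s1 ''used'' = (\<lambda>_. 0)" "snd s1 ''S'' = (\<lambda>_. 0)"
      using f1 by (simp_all add: frame_def defs zero zeroA)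
    have "runs run_auction s1 ((?R * (?R + 2) + 1) * (?k * 40 + 100) + 10) (\<lambda>s2.
      auction ?E (snd s2 ''p'') (snd s2 ''q'') (snd s2 ''own'') \<and>
      (\<forall>(l, r)\<in>?E. snd s2 ''q'' l = 0 \<longrightarrow> ?R + 2 \<le> snd s2 ''p'' r))"
    proof (rule runs_weaken[OF runs_auction[of s1 ?R "?R + 2" "fst s1 ''k''"]])
      show "r < ?R" if "(l, r) \<in> edges s1" for l r using that s1 layered_bound by auto
      show "(?R * (?R + 2) + 1) * (fst s1 ''k'' * 40 + 100) + 10 \<le> (?R * (?R + 2) + 1) * (?k * 40 + 100) + 10"
        using s1 by (intro add_mono mult_mono) auto
    qed (use s1 z1 in auto)
    then show "runs (run_auction ;; find_gap ;; ?mark) s1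
      (((?R * (?R + 2) + 1) * (?k * 40 + 100) + 10) + ((?R * 30 + 50) + (?R * 80 + 7) + 1) + 1)
      (\<lambda>s. feasible L G col (output_set G s) \<and> card (output_set G s) \<le> L * OPT L G col)"
    proof (rule runs_Seq)
      fix s2 assume f2: "frame run_auction s1 s2"
        and s2: "auction ?E (snd s2 ''p'') (snd s2 ''q'') (snd s2 ''own'') \<and>
          (\<forall>(l, r)\<in>?E. snd s2 ''q'' l = 0 \<longrightarrow> ?R + 2 \<le> snd s2 ''p'' r)"
      have f2': "fst s2 ''R'' = ?R" "fst s2 ''n'' = n" "fst s2 ''b'' = Suc L * n" "fst s2 ''v'' = 0"
          "snd s2 ''used'' = (\<lambda>_. 0)" "snd s2 ''S'' = (\<lambda>_. 0)"
        using f2 s1 l1 z1 by (simp_all add: frame_def defs)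
      show "runs (find_gap ;; ?mark) s2 ((?R * 30 + 50) + (?R * 80 + 7) + 1)
        (\<lambda>s. feasible L G col (output_set G s) \<and> card (output_set G s) \<le> L * OPT L G col)"
      proof (rule runs_Seq[OF runs_find_gap])
        fix s3 assume f3: "frame find_gap s2 s3"
          and s3: "0 < fst s3 ''t'' \<and> fst s3 ''t'' \<le> ?R + 1 \<and> fst s3 ''t'' \<notin> snd s2 ''p'' ` {..<?R}"
        define p q t where "p = snd s3 ''p''" and "q = snd s3 ''q''" and "t = fst s3 ''t''"
        have eq: "snd s2 ''p'' = p" "snd s2 ''q'' = q"
          using f3 by (simp_all add: frame_def defs p_def q_def)
        have auc: "auction ?E p q (snd s2 ''own'')"
          and free: "\<forall>(l, r)\<in>?E. q l = 0 \<longrightarrow> ?R + 2 \<le> p r"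
          using s2 eq by auto
        have t: "0 < t" "t \<le> ?R + 1" "t \<notin> p ` {..<?R}" using s3 eq by (auto simp: t_def)
        \<comment> \<open>Priced nodes are right ends of edges, so all prices from \<open>?R\<close>
          on are 0; as \<open>t > 0\<close>, a value missing below \<open>?R\<close> is missing
          everywhere.\<close>
        have p0: "p r = 0" if "\<not> r < ?R" for r
          using auc layered_bound that unfolding auction_def by blast
        have gap: "t \<notin> range p"
        proof
          assume "t \<in> range p"
          then obtain r where "t = p r" by blast
          with t p0 show False by (cases "r < ?R") auto
        qed
        have fin: "finite {r. p r > 0}"
          by (rule finite_subset[of _ "{..<?R}"]) (use p0 in force, simp)
        let ?A = "{l. 0 < q l \<and> q l < t}" and ?B = "{r. t < p r}"
        let ?S = "cut_of L n ?A ?B"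
        \<comment> \<open>Unmatched left nodes see only prices of at least \<open>?R + 2\<close>,
          above any gap found.\<close>
        have stable: "\<forall>(l, r)\<in>?E. q l = 0 \<longrightarrow> t < p r"
          using free t by fastforce
        note cover = auction_cover[OF auc fin stable gap]
        obtain S where S: "feasible L G col S" "card S = OPT L G col"
          using OPT_attained(1)[OF L_pos] by blast
        obtain A B where AB: "covers A B ?E" "finite A" "finite B" "card A + card B \<le> L * n + L * card S"
          using cover_of_feasible[OF S(1)] by blast
        \<comment> \<open>The chain is \<open>L * n + card ?S\<close> \<le>
          \<open>card ?A + card ?B\<close> \<le> size of the matching \<le>
          \<open>card A + card B\<close> \<le> \<open>L * n + L * card S\<close>; then
          \<open>L * n\<close> cancels.\<close>
        have "L * n + card ?S \<le> L * n + L * card S"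
          using card_cut_of[OF cover(1-3)] cover(4) auction_le_cover(2)[OF auc AB(1-3)] AB(4)
          by linarith
        then have "feasible L G col ?S \<and> card ?S \<le> L * OPT L G col"
          using feasible_cut_of[OF cover(1)] S(2) by simp
        moreover have "runs ?mark s3 (?R * 80 + 7) (\<lambda>s. output_set G s = ?S)"
          unfolding p_def q_def t_def
          by (rule runs_mark) (use f3 f2' assms in \<open>simp_all add: frame_def defs\<close>)
        ultimately show "runs ?mark s3 (?R * 80 + 7)
          (\<lambda>s. feasible L G col (output_set G s) \<and> card (output_set G s) \<le> L * OPT L G col)"
          by (elim runs_weaken) auto
      qed (use f2' in auto)
    qed
  qed
  then have "runs bootstrap ?s (bcost (Less (V ''L'') (V ''n'')) +
    ((n * 40 + L * (n * 40 + m * 100 + 50) + 50) +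
     (((?R * (?R + 2) + 1) * (?k * 40 + 100) + 10) + ((?R * 30 + 50) + (?R * 80 + 7) + 1) + 1) + 1) + 1)
    (\<lambda>s. feasible L G col (output_set G s) \<and> card (output_set G s) \<le> L * OPT L G col)"
    unfolding bootstrap_def
    by (rule runs_If) (use assms loaded_initial in \<open>simp add: loaded_def\<close>)
  then show ?thesis
    by (rule runs_weaken) (auto simp: time_bound_def Let_def)
qed

lemma runs_bootstrap_trivial:
  assumes "n \<le> L"
  shows "runs bootstrap (initial_state L G col) 5
    (\<lambda>s. feasible L G col (output_set G s) \<and> card (output_set G s) \<le> L * OPT L G col)"
proof -
  let ?s = "initial_state L G col"
  have "output_set G ?s = {}" by (simp add: output_set_def initial_state_def)
  moreover have "feasible L G col {}"
    unfolding feasible_def using level_le_card assms by (meson empty_subsetI le_trans)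
  ultimately have "runs Skip ?s (ccost Skip)
    (\<lambda>s. feasible L G col (output_set G s) \<and> card (output_set G s) \<le> L * OPT L G col)"
    by (intro runs_effect) auto
  then have "runs bootstrap ?s (bcost (Less (V ''L'') (V ''n'')) + ccost Skip + 1)
    (\<lambda>s. feasible L G col (output_set G s) \<and> card (output_set G s) \<le> L * OPT L G col)"
    unfolding bootstrap_def
    by (intro runs_If) (use assms loaded_initial in \<open>simp_all add: loaded_def\<close>)
  then show ?thesis by (rule runs_weaken) auto
qed

text \<open>The value of \<open>L\<close> can be exponential in the input size, but the bound
  involving \<open>L\<close> is invoked only for \<open>L < n\<close>, where \<open>L\<close> is at
  most the size; otherwise the time is constant.\<close>

lemma runs_bootstrap_poly:
  "runs bootstrap (initial_state L G col) (poly (time_bound [:0, 1:] [:0, 1:] [:0, 1:]) (input_size L G))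
    (\<lambda>s. feasible L G col (output_set G s) \<and> card (output_set G s) \<le> L * OPT L G col)"
proof -
  define x where "x = input_size L G"
  have le: "n \<le> x" "m \<le> x" by (simp_all add: x_def input_size_def)
  have X: "poly [:0, 1:] x = x" by simp
  \<comment> \<open>\<open>[:0, 1:]\<close> is the indeterminate, and evaluation commutes with sums
    and products.\<close>
  have poly: "poly (time_bound [:0, 1:] [:0, 1:] [:0, 1:]) x = time_bound x x x"
    unfolding time_bound_def Let_def by (simp only: poly_add poly_mult poly_numeral poly_1 X)
  have "runs bootstrap (initial_state L G col) (time_bound x x x)
    (\<lambda>s. feasible L G col (output_set G s) \<and> card (output_set G s) \<le> L * OPT L G col)"
  proof (cases "L < n")
    case True
    then have "L \<le> x" using le by simp
    then have "time_bound n m L \<le> time_bound x x x"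
      unfolding time_bound_def Let_def
      by (intro add_mono mult_mono order_refl zero_le) (rule le | assumption)+
    with runs_bootstrap[OF True] show ?thesis by (rule runs_weaken)
  next
    case False
    have "5 \<le> time_bound x x x"
      unfolding time_bound_def Let_def by (rule trans_le_add2) simp
    with runs_bootstrap_trivial show ?thesis by (rule runs_weaken) (use False in auto)
  qed
  then show ?thesis by (simp only: poly x_def[symmetric])
qed

end

theorem theorem1:
  shows "\<exists>(c :: com) (p :: nat poly). \<forall>L G col. bootstrap_input L G col \<longrightarrow>
    (\<exists>t s. exec c (initial_state L G col) t s \<and>
       t \<le> poly p (input_size L G) \<and>
       feasible L G col (output_set G s) \<and>
       card (output_set G s) \<le> L * OPT L G col)"
\<comment> \<open>Both witnesses stay schematic until the final \<open>show\<close> fixes them;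
  introduced before \<open>L\<close>, \<open>G\<close> and \<open>col\<close>, they are uniform in
  the instance.\<close>
proof (rule exI, rule exI, intro allI impI)
  fix L :: nat and G :: "(nat, nat) pre_digraph" and col
  assume "bootstrap_input L G col"
  then interpret bootstrap_instance L G col by unfold_locales
  show "\<exists>t s. exec bootstrap (initial_state L G col) t s \<and>
       t \<le> poly (time_bound [:0, 1:] [:0, 1:] [:0, 1:]) (input_size L G) \<and>
       feasible L G col (output_set G s) \<and>
       card (output_set G s) \<le> L * OPT L G col"
    using runs_bootstrap_poly unfolding runs_def .
qed

end
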